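(* Let $a>0$ and $r$ be real numbers, let $g_a$ be the Hawking Taub-NUT metric on $\mathbf{R}^4$, and let $V_r$ be the vector field on $\mathbf{R}^4$ given by $$V_r=r\left(x^4\frac{\partial}{\partial x^1}-x^3\frac{\partial}{\partial x^2}+x^2\frac{\partial}{\partial x^3}-x^1\frac{\partial}{\partial x^4}\right).$$ Define $\Omega_{a,r}=\{x\in\mathbf{R}^4 : |x|<\frac{1}{\sqrt{r^2-a}}\}$ if $r^2>a$, and $\Omega_{a,r}=\mathbf{R}^4$ otherwise. Let $F=\alpha+\beta$ be the Randers metric given by the navigation representation $(g_a,V_r)$. Then $F$ is an Einstein metric with non-constant flag curvature on $\Omega_{a,r}$.
   Context: Let $x=(x^1,x^2,x^3,x^4)$ denote the standard coordinates on $\mathbf{R}^4$ (superscripts are indices) and $|x|$ the Euclidean norm. For $a>0$, the Hawking Taub-NUT metric on $\mathbf{R}^4$ is the Riemannian metric $$g_a=(a|x|^2+1)\,g_0-\frac{a(a|x|^2+2)}{a|x|^2+1}\,\omega^2,$$ where $g_0=\sum_{i=1}^4 (dx^i)^2$ and $\omega=-x^2dx^1+x^1dx^2-x^4dx^3+x^3dx^4$ (here $\omega^2=\omega\otimes\omega$). A Randers metric on a manifold $M$ is a Finsler metric of the form $F=\alpha+\beta$, where $\alpha=\sqrt{a_{ij}(x)y^iy^j}$ is a Riemannian metric and $\beta=b_i(x)y^i$ is a 1-form. Given a Riemannian metric $g=(g_{ij})$ and a vector field $V=V^i\frac{\partial}{\partial x^i}$, put $V_i=g_{ij}V^j$ and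 $\|V\|_g=\sqrt{V_iV^i}$. A pair $(g,V)$ with $\|V\|_g<1$ is the (Zermelo) navigation representation of the Randers metric $F=\alpha+\beta$ if $$a_{ij}=\frac{g_{ij}}{1-\|V\|_g^2}+\frac{V_iV_j}{(1-\|V\|_g^2)^2},\qquad b_i=-\frac{V_i}{1-\|V\|_g^2}.$$ For a Finsler metric $F$ on an $n$-manifold $M$, let $g_y$ be the fundamental tensor, with components $g_{ij}(x,y)=\frac12[F^2]_{y^iy^j}$ and inverse $(g^{ij})$. The spray coefficients are $G^i=\frac14 g^{il}\left([F^2]_{x^ky^l}y^k-[F^2]_{x^l}\right)$, and the Riemann tensor $\mathbf{R}_y(u)=R^i_{\ k}(x,y)u^k\frac{\partial}{\partial x^i}$ has coefficients $$R^i_{\ k}=2\frac{\partial G^i}{\partial x^k}-y^j\frac{\partial^2G^i}{\partial x^j\partial y^k}+2G^j\frac{\partial^2G^i}{\partial y^j\partial y^k}-\frac{\partial G^i}{\partial y^j}\frac{\partial G^j}{\partial y^k}.$$ For a tangent plane $P=\mathrm{span}(y,u)$ with flag pole $y\neq 0$, the flag curvature is $$K(P,y)=\frac{g_y(\mathbf{R}_y(u),u)}{g_y(y,y)g_y(u,u)-g_y(y,u)^2}.$$ $F$ is of constant flag curvature if there is a constant $\lambda$ with $K(P,y)=\lambda$ for every nonzero tangent vector $y$ and every tangent plane $P$ containing $y$; $F$ has non-constant flag curvature if it is not of constant flag curvature. The Ricci curvature is $Ric(x,y)=R^i_{\ i}(x,y)$, and $F$ is an Einstein metric if there is a scalar function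 $K=K(x)$ on $M$ with $Ric=(n-1)KF^2$.
   Formalization: The claim is stated on the part of Ω_{a,r} where ‖V_r‖_{g_a}<1, not on all of it: for r≠0 this inequality fails somewhere in Ω_{a,r} (at (s,0,0,0), ‖V_r‖²=r²s²(as²+1)), so the Randers metric is not defined on all of Ω_{a,r}. *)

theory Defs
  imports "HOL-Analysis.Analysis"
begin

section \<open>Finsler metrics on open subsets of coordinate space\<close>

text \<open>A Finsler metric is given in the standard coordinates as a function \<open>F x y\<close> of the point
  \<open>x\<close> and the tangent vector \<open>y\<close>.\<close>

definition pderiv_at :: "'n \<Rightarrow> (real ^ 'n \<Rightarrow> real) \<Rightarrow> real ^ 'n \<Rightarrow> real" where
  "pderiv_at i f x = deriv (\<lambda>t. f (x + t *\<^sub>R axis i 1)) 0"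

abbreviation ddx :: "'n \<Rightarrow> (real ^ 'n \<Rightarrow> real ^ 'n \<Rightarrow> real) \<Rightarrow> real ^ 'n \<Rightarrow> real ^ 'n \<Rightarrow> real" where
  "ddx i H \<equiv> (\<lambda>x y. pderiv_at i (\<lambda>z. H z y) x)"

abbreviation ddy :: "'n \<Rightarrow> (real ^ 'n \<Rightarrow> real ^ 'n \<Rightarrow> real) \<Rightarrow> real ^ 'n \<Rightarrow> real ^ 'n \<Rightarrow> real" where
  "ddy i H \<equiv> (\<lambda>x y. pderiv_at i (\<lambda>z. H x z) y)"

primrec C_k_on :: "nat \<Rightarrow> 'a::real_normed_vector set \<Rightarrow> ('a \<Rightarrow> real) \<Rightarrow> bool" where
  "C_k_on 0 S f \<longleftrightarrow> continuous_on S f"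
| "C_k_on (Suc k) S f \<longleftrightarrow>
     (\<exists>f'. (\<forall>x\<in>S. (f has_derivative f' x) (at x)) \<and> (\<forall>v. C_k_on k S (\<lambda>x. f' x v)))"

definition smooth_on :: "'a::real_normed_vector set \<Rightarrow> ('a \<Rightarrow> real) \<Rightarrow> bool" where
  "smooth_on S f \<longleftrightarrow> (\<forall>k. C_k_on k S f)"

definition energy :: "(real ^ 'n \<Rightarrow> real ^ 'n \<Rightarrow> real) \<Rightarrow> real ^ 'n \<Rightarrow> real ^ 'n \<Rightarrow> real" where
  "energy F x y = (F x y)\<^sup>2"

definition fundamental_tensor ::
    "(real ^ 'n \<Rightarrow> real ^ 'n \<Rightarrow> real) \<Rightarrow> real ^ 'n \<Rightarrow> real ^ 'n \<Rightarrow> real ^ 'n ^ 'n" where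
  "fundamental_tensor F x y = (\<chi> i j. 1/2 * ddy j (ddy i (energy F)) x y)"

definition bilin :: "real ^ 'n ^ 'n \<Rightarrow> real ^ 'n \<Rightarrow> real ^ 'n \<Rightarrow> real" where
  "bilin A u v = u \<bullet> (A *v v)"

definition finsler_metric_on ::
    "(real ^ 'n) set \<Rightarrow> (real ^ 'n \<Rightarrow> real ^ 'n \<Rightarrow> real) \<Rightarrow> bool" where
  "finsler_metric_on M F \<longleftrightarrow>
     open M \<and>
     smooth_on (M \<times> (UNIV - {0})) (\<lambda>(x, y). F x y) \<and>
     (\<forall>x\<in>M. \<forall>y. 0 \<le> F x y) \<and>
     (\<forall>x\<in>M. \<forall>y. \<forall>c>0. F x (c *\<^sub>R y) = c * F x y) \<and>
     (\<forall>x\<in>M. \<forall>y. y \<noteq> 0 \<longrightarrow> (\<forall>u. u \<noteq> 0 \<longrightarrow> 0 < bilin (fundamental_tensor F x y) u u))"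

definition spray :: "(real ^ 'n \<Rightarrow> real ^ 'n \<Rightarrow> real) \<Rightarrow> 'n \<Rightarrow> real ^ 'n \<Rightarrow> real ^ 'n \<Rightarrow> real" where
  "spray F i x y =
     1/4 * (\<Sum>l\<in>UNIV. matrix_inv (fundamental_tensor F x y) $ i $ l *
       ((\<Sum>k\<in>UNIV. ddy l (ddx k (energy F)) x y * y $ k) - ddx l (energy F) x y))"

text \<open>Row index \<open>i\<close> is the upper index of \<open>R\<^sup>i\<^sub>k\<close>.\<close>

definition riemann :: "(real ^ 'n \<Rightarrow> real ^ 'n \<Rightarrow> real) \<Rightarrow> real ^ 'n \<Rightarrow> real ^ 'n \<Rightarrow> real ^ 'n ^ 'n" where
  "riemann F x y = (\<chi> i k.
     2 * ddx k (spray F i) x y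
     - (\<Sum>j\<in>UNIV. y $ j * ddx j (ddy k (spray F i)) x y)
     + 2 * (\<Sum>j\<in>UNIV. spray F j x y * ddy j (ddy k (spray F i)) x y)
     - (\<Sum>j\<in>UNIV. ddy j (spray F i) x y * ddy k (spray F j) x y))"

definition flag_curvature ::
    "(real ^ 'n \<Rightarrow> real ^ 'n \<Rightarrow> real) \<Rightarrow> real ^ 'n \<Rightarrow> real ^ 'n \<Rightarrow> real ^ 'n \<Rightarrow> real" where
  "flag_curvature F x y u =
     (let g = bilin (fundamental_tensor F x y)
      in g (riemann F x y *v u) u / (g y y * g u u - (g y u)\<^sup>2))"

text \<open>The condition \<open>dim {y, u} = 2\<close> says that \<open>y\<close> and \<open>u\<close> span a tangent plane; in particular
  the flag pole \<open>y\<close> is nonzero.\<close>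

definition constant_flag_curvature_on ::
    "(real ^ 'n) set \<Rightarrow> (real ^ 'n \<Rightarrow> real ^ 'n \<Rightarrow> real) \<Rightarrow> bool" where
  "constant_flag_curvature_on M F \<longleftrightarrow>
     (\<exists>c. \<forall>x\<in>M. \<forall>y u. dim {y, u} = 2 \<longrightarrow> flag_curvature F x y u = c)"

definition ricci :: "(real ^ 'n \<Rightarrow> real ^ 'n \<Rightarrow> real) \<Rightarrow> real ^ 'n \<Rightarrow> real ^ 'n \<Rightarrow> real" where
  "ricci F x y = trace (riemann F x y)"

definition einstein_metric_on ::
    "(real ^ 'n) set \<Rightarrow> (real ^ 'n \<Rightarrow> real ^ 'n \<Rightarrow> real) \<Rightarrow> bool" where
  "einstein_metric_on M F \<longleftrightarrow>
     finsler_metric_on M F \<and>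
     (\<exists>K. \<forall>x\<in>M. \<forall>y. y \<noteq> 0 \<longrightarrow>
        ricci F x y = (real CARD('n) - 1) * K x * (F x y)\<^sup>2)"

section \<open>Randers metrics from navigation data\<close>

definition metric_norm :: "real ^ 'n ^ 'n \<Rightarrow> real ^ 'n \<Rightarrow> real" where
  "metric_norm A v = sqrt (bilin A v v)"

text \<open>The pair \<open>(g, V)\<close> is navigation data only where \<open>V\<close> has \<open>g\<close>-norm less than 1; the formulas
  below are meaningless elsewhere.\<close>

definition navigation_domain ::
    "(real ^ 'n \<Rightarrow> real ^ 'n ^ 'n) \<Rightarrow> (real ^ 'n \<Rightarrow> real ^ 'n) \<Rightarrow> (real ^ 'n) set" where
  "navigation_domain g V = {x. metric_norm (g x) (V x) < 1}"

definition navigation_alpha ::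
    "(real ^ 'n \<Rightarrow> real ^ 'n ^ 'n) \<Rightarrow> (real ^ 'n \<Rightarrow> real ^ 'n) \<Rightarrow> real ^ 'n \<Rightarrow> real ^ 'n ^ 'n" where
  "navigation_alpha g V x =
     (let V' = g x *v V x; l = 1 - (metric_norm (g x) (V x))\<^sup>2
      in (\<chi> i j. g x $ i $ j / l + V' $ i * V' $ j / l\<^sup>2))"

definition navigation_beta ::
    "(real ^ 'n \<Rightarrow> real ^ 'n ^ 'n) \<Rightarrow> (real ^ 'n \<Rightarrow> real ^ 'n) \<Rightarrow> real ^ 'n \<Rightarrow> real ^ 'n" where
  "navigation_beta g V x =
     (let V' = g x *v V x; l = 1 - (metric_norm (g x) (V x))\<^sup>2
      in (\<chi> i. - (V' $ i) / l))"

definition randers_of_navigation ::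
    "(real ^ 'n \<Rightarrow> real ^ 'n ^ 'n) \<Rightarrow> (real ^ 'n \<Rightarrow> real ^ 'n) \<Rightarrow> real ^ 'n \<Rightarrow> real ^ 'n \<Rightarrow> real" where
  "randers_of_navigation g V x y =
     metric_norm (navigation_alpha g V x) y + navigation_beta g V x \<bullet> y"

section \<open>The Hawking Taub-NUT metric\<close>

definition taub_nut_form :: "real ^ 4 \<Rightarrow> real ^ 4" where
  "taub_nut_form x = vector [- (x $ 2), x $ 1, - (x $ 4), x $ 3]"

definition taub_nut :: "real \<Rightarrow> real ^ 4 \<Rightarrow> real ^ 4 ^ 4" where
  "taub_nut a x = (\<chi> i j.
     (a * (norm x)\<^sup>2 + 1) * (if i = j then 1 else 0)
     - a * (a * (norm x)\<^sup>2 + 2) / (a * (norm x)\<^sup>2 + 1) * (taub_nut_form x $ i * taub_nut_form x $ j))"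

definition wind :: "real \<Rightarrow> real ^ 4 \<Rightarrow> real ^ 4" where
  "wind r x = r *\<^sub>R vector [x $ 4, - (x $ 3), x $ 2, - (x $ 1)]"

text \<open>The condition that \<open>wind r\<close> has norm less than 1 does not follow from membership in \<open>Omega a r\<close>
  when \<open>r\<close> is nonzero: at \<open>(s,0,0,0)\<close> the squared norm is \<open>r\<^sup>2 * s\<^sup>2 * (a * s\<^sup>2 + 1)\<close>. Hence the Randers
  metric lives on \<open>Omega a r \<inter> navigation_domain (taub_nut a) (wind r)\<close>.\<close>

definition Omega :: "real \<Rightarrow> real \<Rightarrow> (real ^ 4) set" where
  "Omega a r = (if r\<^sup>2 > a then {x. norm x < 1 / sqrt (r\<^sup>2 - a)} else UNIV)"

end

theory Submission
  imports Defs
begin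

text \<open>The metric \<open>g\<^sub>a\<close> is Ricci flat, and \<open>V\<^sub>r\<close> is a linear Killing field \<open>W x\<close> whose flow consists of unitary maps
  commuting with the complex structure \<open>J\<close> behind \<open>\<omega>\<close>. Put \<open>\<xi> = y - F(x, y) V\<close>, so that \<open>g(\<xi>, \<xi>) = F\<^sup>2\<close>. For Killing
  wind the geodesics of \<open>F\<close> are those of \<open>g\<close> transported by the flow, which yields the spray of \<open>F\<close> in closed form, and
  then
  \<open>R\<^sup>F\<^sub>y(u) = R\<^sup>g\<^sub>\<xi>(u) - dF\<^sub>y(u) R\<^sup>g\<^sub>\<xi>(V)\<close>
  for the Jacobi endomorphisms. As \<open>dF\<^sub>y\<close> is proportional to \<open>g(\<xi>, \<cdot>)\<close>, which annihilates the image of \<open>R\<^sup>g\<^sub>\<xi>\<close>, the traces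
  agree and \<open>F\<close> is Ricci flat. At the origin \<open>V\<close> vanishes, so \<open>F\<close> has the sectional curvatures of \<open>g\<^sub>a\<close> there, and
  \<open>4 a\<close> and \<open>- 2 a\<close> both occur.\<close>

section \<open>Coordinate partial derivatives and finite-dimensional linear algebra\<close>

lemma pderiv_at_eq:
  assumes "(f has_derivative f') (at x)"
  shows "pderiv_at i f x = f' (axis i 1)"
proof -
  have "((\<lambda>t. f (x + t *\<^sub>R axis i 1)) has_derivative (\<lambda>t. f' (t *\<^sub>R axis i 1))) (at 0)"
    by (rule has_derivative_compose[where g = f and f = "\<lambda>t. x + t *\<^sub>R axis i 1"])
      (use assms in \<open>auto intro!: derivative_eq_intros\<close>)
  moreover have "f' (t *\<^sub>R axis i 1) = f' (axis i 1) * t" for t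
    using linear_scale[OF has_derivative_linear[OF assms]] by simp
  ultimately have "((\<lambda>t. f (x + t *\<^sub>R axis i 1)) has_real_derivative f' (axis i 1)) (at 0)"
    by (simp add: has_field_derivative_def)
  then show ?thesis
    unfolding pderiv_at_def by (rule DERIV_imp_deriv)
qed

text \<open>Closed forms for the iterated derivatives are available only on an open part of the
  tangent bundle; a partial derivative sees the germ alone, so that is enough.\<close>

lemma pderiv_at_cong_open:
  assumes "open S" "x \<in> S" "\<And>z. z \<in> S \<Longrightarrow> f z = h z"
  shows "pderiv_at i f x = pderiv_at i h x"
proof -
  have "open ((\<lambda>t. x + t *\<^sub>R axis i 1) -` S)"
    by (intro open_vimage assms continuous_intros)
  then have "\<forall>\<^sub>F t in nhds 0. x + t *\<^sub>R axis i 1 \<in> S"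
    using eventually_nhds_in_open[of "(\<lambda>t. x + t *\<^sub>R axis i 1) -` S" 0] assms(2) by simp
  then show ?thesis
    unfolding pderiv_at_def
    by (intro deriv_cong_ev) (auto elim: eventually_mono simp: assms(3))
qed

text \<open>Chain rule along the slice through \<open>(x, y)\<close>. Here \<open>H\<close> may
  itself be a partial derivative with closed form \<open>K\<close> on \<open>T\<close> only, so this
  lemma and \<open>ddy_eq\<close> can be iterated.\<close>

lemma ddx_eq:
  assumes "open T" "(x, y) \<in> T" "\<And>z w. (z, w) \<in> T \<Longrightarrow> H z w = K (z, w)"
    and "(K has_derivative K') (at (x, y))"
  shows "ddx i H x y = K' (axis i 1, 0)"
proof -
  have "((\<lambda>z. K (z, y)) has_derivative (\<lambda>d. K' (d, 0))) (at x)"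
    by (rule has_derivative_compose[where g = K and f = "\<lambda>z. (z, y)"])
      (use assms(4) in \<open>auto intro!: derivative_eq_intros\<close>)
  moreover have "pderiv_at i (\<lambda>z. H z y) x = pderiv_at i (\<lambda>z. K (z, y)) x"
  proof (rule pderiv_at_cong_open)
    show "open ((\<lambda>z. (z, y)) -` T)"
      by (intro open_vimage assms continuous_intros)
  qed (use assms in auto)
  ultimately show ?thesis
    by (simp add: pderiv_at_eq)
qed

lemma ddy_eq:
  assumes "open T" "(x, y) \<in> T" "\<And>z w. (z, w) \<in> T \<Longrightarrow> H z w = K (z, w)"
    and "(K has_derivative K') (at (x, y))"
  shows "ddy i H x y = K' (0, axis i 1)"
proof -
  have "((\<lambda>z. K (x, z)) has_derivative (\<lambda>d. K' (0, d))) (at y)"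
    by (rule has_derivative_compose[where g = K and f = "\<lambda>z. (x, z)"])
      (use assms(4) in \<open>auto intro!: derivative_eq_intros\<close>)
  moreover have "pderiv_at i (H x) y = pderiv_at i (\<lambda>z. K (x, z)) y"
  proof (rule pderiv_at_cong_open)
    show "open ((\<lambda>z. (x, z)) -` T)"
      by (intro open_vimage assms continuous_intros)
  qed (use assms in auto)
  ultimately show ?thesis
    by (simp add: pderiv_at_eq)
qed

lemma sum_scaleR_axis: "(\<Sum>i\<in>UNIV. u $ i *\<^sub>R axis i 1) = (u :: real ^ 'n)"
  using basis_expansion[of u] by (simp add: scalar_mult_eq_scaleR)

lemma linear_eq_sum_axis:
  fixes f :: "real ^ 'n \<Rightarrow> 'b::real_vector"
  assumes "linear f"
  shows "f u = (\<Sum>i\<in>UNIV. u $ i *\<^sub>R f (axis i 1))"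
proof -
  have "f u = f (\<Sum>i\<in>UNIV. u $ i *\<^sub>R axis i 1)"
    by (simp add: sum_scaleR_axis)
  then show ?thesis
    by (simp add: linear_sum[OF assms] linear_scale[OF assms])
qed

lemmas bilinear_simps = bilinear_ladd bilinear_radd bilinear_lsub bilinear_rsub bilinear_lneg bilinear_rneg
  bilinear_lmul bilinear_rmul bilinear_lzero bilinear_rzero

lemmas linear_simps = linear_add linear_diff linear_neg linear_scale linear_0

lemma matrix_mult_eq_linear:
  fixes f :: "real ^ 'n \<Rightarrow> real ^ 'm"
  assumes "linear f" and "\<And>i k. A $ i $ k = f (axis k 1) $ i"
  shows "A *v u = f u"
  by (simp add: vec_eq_iff linear_eq_sum_axis[OF assms(1), of u] matrix_vector_mult_def assms(2) mult.commute)

lemma bilin_eq_bilinear: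
  assumes "bilinear B" and "\<And>i j. A $ i $ j = B (axis i 1) (axis j 1)"
  shows "bilin A u w = B u w"
proof -
  have "B u w = (\<Sum>i\<in>UNIV. u $ i * B (axis i 1) w)"
    using linear_eq_sum_axis[of "\<lambda>u. B u w" u] assms(1) by (simp add: bilinear_def)
  moreover have "B (axis i 1) w = (\<Sum>j\<in>UNIV. w $ j * B (axis i 1) (axis j 1))" for i
    using linear_eq_sum_axis[of "B (axis i 1)" w] assms(1) by (simp add: bilinear_def)
  ultimately have "B u w = (\<Sum>i\<in>UNIV. u $ i * (\<Sum>j\<in>UNIV. w $ j * B (axis i 1) (axis j 1)))"
    by simp
  then show ?thesis
    by (simp add: bilin_def inner_vec_def matrix_vector_mult_def assms(2) mult.commute)
qed

lemma invertible_if_pos_def: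
  fixes A :: "real ^ 'n ^ 'n"
  assumes "\<And>u. u \<noteq> 0 \<Longrightarrow> 0 < bilin A u u"
  shows "invertible A"
proof -
  have "u = 0" if "A *v u = 0" for u
    using assms[of u] that by (cases "u = 0") (simp_all add: bilin_def)
  then show ?thesis
    by (simp add: invertible_left_inverse matrix_left_invertible_ker)
qed

lemma matrix_inv_mult:
  fixes A :: "real ^ 'n ^ 'n"
  assumes "invertible A"
  shows "matrix_inv A ** A = mat 1"
  using someI_ex[OF assms[unfolded invertible_def]] unfolding matrix_inv_def by blast

lemma dim_orthogonal_pair:
  fixes u w :: "'a::euclidean_space"
  assumes "u \<noteq> 0" "w \<noteq> 0" "u \<bullet> w = 0"
  shows "dim {u, w} = 2"
proof -
  have "u \<noteq> w"
    using assms by auto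
  moreover have "independent {u, w}"
    by (rule pairwise_orthogonal_independent)
      (use assms in \<open>auto simp: pairwise_def orthogonal_def inner_commute\<close>)
  ultimately show ?thesis
    using dim_eq_card_independent[of "{u, w}"] by simp
qed

section \<open>Smooth functions\<close>

text \<open>At the bottom differentiability gives continuity; above it the induction passes to the
  directional derivatives.\<close>

lemma C_k_on_SucD: "C_k_on (Suc k) S f \<Longrightarrow> C_k_on k S f"
proof (induction k arbitrary: f)
  case 0
  then obtain f' where "\<forall>x\<in>S. (f has_derivative f' x) (at x)"
    by auto
  then show ?case
    using has_derivative_continuous by (force intro!: continuous_at_imp_continuous_on)
next
  case (Suc k)
  from Suc.prems obtain f' where "\<forall>x\<in>S. (f has_derivative f' x) (at x)"
      "\<forall>v. C_k_on (Suc k) S (\<lambda>x. f' x v)"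
    by (auto simp only: C_k_on.simps(2)[of "Suc k"])
  with Suc.IH show ?case
    by (simp only: C_k_on.simps(2)) blast
qed

lemma C_k_on_const: "C_k_on k S (\<lambda>x. c)"
proof (induction k arbitrary: c)
  case (Suc k)
  show ?case
    unfolding C_k_on.simps by (rule exI[where x = "\<lambda>x v. 0"]) (auto intro: Suc)
qed simp

lemma C_k_on_linear:
  assumes "bounded_linear f"
  shows "C_k_on k S f"
proof (cases k)
  case 0
  then show ?thesis
    using assms by (simp add: linear_continuous_on)
next
  case (Suc k)
  show ?thesis
    unfolding C_k_on.simps Suc
    by (rule exI[where x = "\<lambda>x. f"]) (auto intro: C_k_on_const bounded_linear_imp_has_derivative assms)
qed

lemma C_k_on_add:
  assumes "C_k_on k S f" "C_k_on k S h"
  shows "C_k_on k S (\<lambda>x. f x + h x)"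
  using assms
proof (induction k arbitrary: f h)
  case (Suc k)
  from Suc.prems obtain f' h' where *: "\<forall>x\<in>S. (f has_derivative f' x) (at x)"
      "\<forall>v. C_k_on k S (\<lambda>x. f' x v)" "\<forall>x\<in>S. (h has_derivative h' x) (at x)"
      "\<forall>v. C_k_on k S (\<lambda>x. h' x v)"
    by auto
  show ?case
    unfolding C_k_on.simps
    by (rule exI[where x = "\<lambda>x v. f' x v + h' x v"])
      (use * in \<open>auto intro!: Suc.IH derivative_intros\<close>)
qed (auto intro!: continuous_intros)

lemma C_k_on_mult:
  assumes "C_k_on k S f" "C_k_on k S h"
  shows "C_k_on k S (\<lambda>x. f x * h x)"
  using assms
proof (induction k arbitrary: f h)
  case (Suc k)
  from Suc.prems obtain f' h' where *: "\<forall>x\<in>S. (f has_derivative f' x) (at x)"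
      "\<forall>v. C_k_on k S (\<lambda>x. f' x v)" "\<forall>x\<in>S. (h has_derivative h' x) (at x)"
      "\<forall>v. C_k_on k S (\<lambda>x. h' x v)"
    by auto
  show ?case
    unfolding C_k_on.simps
    by (rule exI[where x = "\<lambda>x v. f x * h' x v + f' x v * h x"])
      (use * Suc.prems[THEN C_k_on_SucD] in \<open>auto intro!: Suc.IH C_k_on_add derivative_intros\<close>)
qed (auto intro!: continuous_intros)

text \<open>The derivative of \<open>inverse (f x)\<close> contains \<open>inverse (f x)\<close>
  again, so the induction hypothesis for the function itself enters the products that form its
  derivative. \<open>C_k_on_sqrt\<close> works likewise.\<close>

lemma C_k_on_inverse:
  assumes "C_k_on k S f" "\<And>x. x \<in> S \<Longrightarrow> f x \<noteq> 0"
  shows "C_k_on k S (\<lambda>x. inverse (f x))"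
  using assms
proof (induction k)
  case (Suc k)
  from Suc.prems obtain f' where *: "\<forall>x\<in>S. (f has_derivative f' x) (at x)"
      "\<forall>v. C_k_on k S (\<lambda>x. f' x v)"
    by auto
  have "C_k_on k S (\<lambda>x. inverse (f x))"
    using Suc C_k_on_SucD by blast
  then have "C_k_on k S (\<lambda>x. (-1) * (inverse (f x) * f' x v * inverse (f x)))" for v
    using * by (intro C_k_on_mult C_k_on_const) auto
  then show ?case
    unfolding C_k_on.simps using * Suc.prems
    by (intro exI[where x = "\<lambda>x v. (-1) * (inverse (f x) * f' x v * inverse (f x))"])
      (auto intro!: derivative_eq_intros)
qed (auto intro!: continuous_intros)

lemma C_k_on_sqrt:
  assumes "C_k_on k S f" "\<And>x. x \<in> S \<Longrightarrow> f x > 0"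
  shows "C_k_on k S (\<lambda>x. sqrt (f x))"
  using assms
proof (induction k)
  case (Suc k)
  from Suc.prems obtain f' where *: "\<forall>x\<in>S. (f has_derivative f' x) (at x)"
      "\<forall>v. C_k_on k S (\<lambda>x. f' x v)"
    by auto
  have "C_k_on k S (\<lambda>x. sqrt (f x))"
    using Suc C_k_on_SucD by blast
  then have "C_k_on k S (\<lambda>x. (1/2) * (inverse (sqrt (f x)) * f' x v))" for v
    using * Suc.prems(2) by (intro C_k_on_mult C_k_on_const C_k_on_inverse) (auto simp: less_le)
  then show ?case
    unfolding C_k_on.simps using * Suc.prems
    by (intro exI[where x = "\<lambda>x v. (1/2) * (inverse (sqrt (f x)) * f' x v)"])
      (auto intro!: derivative_eq_intros simp: field_simps)
qed (auto intro!: continuous_intros)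

lemma smooth_on_const: "smooth_on S (\<lambda>x. c)"
  by (simp add: smooth_on_def C_k_on_const)

lemma smooth_on_linear: "bounded_linear f \<Longrightarrow> smooth_on S f"
  by (simp add: smooth_on_def C_k_on_linear)

lemma smooth_on_add: "smooth_on S f \<Longrightarrow> smooth_on S h \<Longrightarrow> smooth_on S (\<lambda>x. f x + h x)"
  by (simp add: smooth_on_def C_k_on_add)

lemma smooth_on_mult: "smooth_on S f \<Longrightarrow> smooth_on S h \<Longrightarrow> smooth_on S (\<lambda>x. f x * h x)"
  by (simp add: smooth_on_def C_k_on_mult)

lemma smooth_on_diff: "smooth_on S f \<Longrightarrow> smooth_on S h \<Longrightarrow> smooth_on S (\<lambda>x. f x - h x)"
  using smooth_on_add[OF _ smooth_on_mult[OF smooth_on_const[of _ "-1"]], of S f h] by simp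

lemma smooth_on_sum:
  "(\<And>i. i \<in> I \<Longrightarrow> smooth_on S (f i)) \<Longrightarrow> smooth_on S (\<lambda>x. \<Sum>i\<in>I. f i x)"
  by (induction I rule: infinite_finite_induct) (auto intro: smooth_on_const smooth_on_add)

lemma smooth_on_inner:
  fixes f h :: "'a::real_normed_vector \<Rightarrow> real ^ 'n"
  assumes "bounded_linear f" "bounded_linear h"
  shows "smooth_on S (\<lambda>x. f x \<bullet> h x)"
  unfolding inner_vec_def inner_real_def
  by (intro smooth_on_sum smooth_on_mult smooth_on_linear
      bounded_linear_compose[OF bounded_linear_vec_nth] assms)

lemma smooth_on_divide:
  "smooth_on S f \<Longrightarrow> smooth_on S h \<Longrightarrow> (\<And>x. x \<in> S \<Longrightarrow> h x \<noteq> 0) \<Longrightarrow> smooth_on S (\<lambda>x. f x / h x)"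
  by (simp add: smooth_on_def divide_inverse C_k_on_mult C_k_on_inverse)

lemma smooth_on_sqrt:
  "smooth_on S f \<Longrightarrow> (\<And>x. x \<in> S \<Longrightarrow> f x > 0) \<Longrightarrow> smooth_on S (\<lambda>x. sqrt (f x))"
  by (simp add: smooth_on_def C_k_on_sqrt)

section \<open>Zermelo navigation with a linear Killing field\<close>

text \<open>\<open>\<Gamma>\<close> is the Levi-Civita connection of \<open>g\<close>;
  \<open>dg\<close> and \<open>d\<Gamma>\<close> are derivatives in the base point, in the direction
  of their second argument. As \<open>W\<close> is linear, its flow is \<open>exp (s W)\<close>, and
  \<open>killing\<close> and \<open>\<Gamma>_equivariant\<close> say infinitesimally that this flow
  preserves \<open>g\<close> and \<open>\<Gamma>\<close>.\<close>

locale killing_navigation =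
  fixes g :: "real ^ 'n \<Rightarrow> real ^ 'n \<Rightarrow> real ^ 'n \<Rightarrow> real"
    and dg :: "real ^ 'n \<Rightarrow> real ^ 'n \<Rightarrow> real ^ 'n \<Rightarrow> real ^ 'n \<Rightarrow> real"
    and \<Gamma> :: "real ^ 'n \<Rightarrow> real ^ 'n \<Rightarrow> real ^ 'n \<Rightarrow> real ^ 'n"
    and d\<Gamma> :: "real ^ 'n \<Rightarrow> real ^ 'n \<Rightarrow> real ^ 'n \<Rightarrow> real ^ 'n \<Rightarrow> real ^ 'n"
    and W :: "real ^ 'n \<Rightarrow> real ^ 'n"
  assumes linear_W: "linear W"
    and bilinear_g: "bilinear (g x)"
    and g_commute: "g x u w = g x w u"
    and g_pos: "u \<noteq> 0 \<Longrightarrow> 0 < g x u u"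
    and bilinear_dg: "bilinear (dg x d)"
    and has_derivative_g:
      "((\<lambda>(x, u, w). g x u w) has_derivative
        (\<lambda>(d, u', w'). dg x d u w + g x u' w + g x u w')) (at (x, u, w))"
    and bilinear_\<Gamma>: "bilinear (\<Gamma> x)"
    and \<Gamma>_commute: "\<Gamma> x u w = \<Gamma> x w u"
    and bilinear_d\<Gamma>: "bilinear (d\<Gamma> x d)"
    and has_derivative_\<Gamma>:
      "((\<lambda>(x, u, w). \<Gamma> x u w) has_derivative
        (\<lambda>(d, u', w'). d\<Gamma> x d u w + \<Gamma> x u' w + \<Gamma> x u w')) (at (x, u, w))"
    and metric_compatible: "dg x d u w = g x (\<Gamma> x d u) w + g x u (\<Gamma> x d w)"
    and killing: "dg x (W x) u w + g x (W u) w + g x u (W w) = 0"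
    and \<Gamma>_equivariant: "d\<Gamma> x (W x) u w + \<Gamma> x (W u) w + \<Gamma> x u (W w) = W (\<Gamma> x u w)"
begin

lemmas W_simps = linear_simps[OF linear_W]

lemmas g_simps = bilinear_simps[OF bilinear_g]

lemmas \<Gamma>_simps = bilinear_simps[OF bilinear_\<Gamma>]

lemma dg_commute: "dg x d u w = dg x d w u"
  by (simp add: metric_compatible g_commute[of x "\<Gamma> x d u"] g_commute[of x u])

text \<open>Inherited from the joint derivative of \<open>g\<close>, evaluated at
  \<open>(d, 0, 0)\<close>.\<close>

lemma linear_dg_direction: "linear (\<lambda>d. dg x d u w)"
proof -
  have "linear (\<lambda>d. case (d, 0, 0) of (d, u', w') \<Rightarrow> dg x d u w + g x u' w + g x u w')"
    by (rule linear_compose[OF _ has_derivative_linear[OF has_derivative_g], unfolded o_def])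
      (auto intro!: linearI simp: zero_prod_def)
  then show ?thesis
    by (simp add: g_simps)
qed

lemma linear_d\<Gamma>_direction: "linear (\<lambda>d. d\<Gamma> x d u w)"
proof -
  have "linear (\<lambda>d. case (d, 0, 0) of (d, u', w') \<Rightarrow> d\<Gamma> x d u w + \<Gamma> x u' w + \<Gamma> x u w')"
    by (rule linear_compose[OF _ has_derivative_linear[OF has_derivative_\<Gamma>], unfolded o_def])
      (auto intro!: linearI simp: zero_prod_def)
  then show ?thesis
    by (simp add: \<Gamma>_simps)
qed

lemmas dg_simps = bilinear_simps[OF bilinear_dg] linear_simps[OF linear_dg_direction]

lemmas d\<Gamma>_simps = bilinear_simps[OF bilinear_d\<Gamma>] linear_simps[OF linear_d\<Gamma>_direction]

lemma g_derivative:
  assumes "(X has_derivative X') (at t)" "(Y has_derivative Y') (at t)" "(Z has_derivative Z') (at t)"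
  shows "((\<lambda>t. g (X t) (Y t) (Z t)) has_derivative
    (\<lambda>d. dg (X t) (X' d) (Y t) (Z t) + g (X t) (Y' d) (Z t) + g (X t) (Y t) (Z' d))) (at t)"
  using has_derivative_compose[OF has_derivative_Pair[OF assms(1) has_derivative_Pair[OF assms(2,3)]]
      has_derivative_g] by simp

lemma \<Gamma>_derivative:
  assumes "(X has_derivative X') (at t)" "(Y has_derivative Y') (at t)" "(Z has_derivative Z') (at t)"
  shows "((\<lambda>t. \<Gamma> (X t) (Y t) (Z t)) has_derivative
    (\<lambda>d. d\<Gamma> (X t) (X' d) (Y t) (Z t) + \<Gamma> (X t) (Y' d) (Z t) + \<Gamma> (X t) (Y t) (Z' d))) (at t)"
  using has_derivative_compose[OF has_derivative_Pair[OF assms(1) has_derivative_Pair[OF assms(2,3)]]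
      has_derivative_\<Gamma>] by simp

lemma W_derivative:
  assumes "(X has_derivative X') (at t)"
  shows "((\<lambda>t. W (X t)) has_derivative (\<lambda>d. W (X' d))) (at t)"
  using bounded_linear.has_derivative assms linear_W linear_conv_bounded_linear by blast

section \<open>The Randers norm as a root of the Zermelo quadratic, and its derivatives\<close>

definition slope :: "real ^ 'n \<Rightarrow> real" where
  "slope x = 1 - g x (W x) (W x)"

definition F :: "(real ^ 'n) \<times> (real ^ 'n) \<Rightarrow> real" where
  "F t = sqrt (g (fst t) (snd t) (snd t) / slope (fst t) + (g (fst t) (W (fst t)) (snd t))\<^sup>2 / (slope (fst t))\<^sup>2)
      - g (fst t) (W (fst t)) (snd t) / slope (fst t)"

definition \<xi> :: "(real ^ 'n) \<times> (real ^ 'n) \<Rightarrow> real ^ 'n" where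
  "\<xi> t = snd t - F t *\<^sub>R W (fst t)"

text \<open>Half the derivative, with respect to \<open>F\<close>, of the quadratic in
  \<open>F_quadratic\<close>; at the chosen root it is the square root of the reduced discriminant
  (\<open>D_eq\<close>), hence positive on \<open>Dom\<close>.\<close>

definition D :: "(real ^ 'n) \<times> (real ^ 'n) \<Rightarrow> real" where
  "D t = F t + g (fst t) (\<xi> t) (W (fst t))"

definition Dom :: "((real ^ 'n) \<times> (real ^ 'n)) set" where
  "Dom = {x. g x (W x) (W x) < 1} \<times> (UNIV - {0})"

lemma open_speed_less: "open {x. g x (W x) (W x) < 1}"
proof -
  have "isCont (\<lambda>x. g x (W x) (W x)) x" for x
    by (rule has_derivative_continuous, rule g_derivative[OF has_derivative_ident
          W_derivative[OF has_derivative_ident] W_derivative[OF has_derivative_ident]])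
  then have "continuous_on UNIV (\<lambda>x. g x (W x) (W x))"
    by (simp add: continuous_at_imp_continuous_on)
  then show ?thesis
    by (intro open_Collect_less continuous_intros)
qed

lemma open_Dom: "open Dom"
  unfolding Dom_def by (intro open_Times open_speed_less) auto

text \<open>Positivity of \<open>g\<close> on \<open>g(w,w) u - g(u,w) w\<close>, a multiple of the
  component of \<open>u\<close> orthogonal to \<open>w\<close>.\<close>

lemma g_Cauchy_Schwarz: "(g x u w)\<^sup>2 \<le> g x u u * g x w w"
proof (cases "w = 0")
  case False
  have "0 \<le> g x (g x w w *\<^sub>R u - g x u w *\<^sub>R w) (g x w w *\<^sub>R u - g x u w *\<^sub>R w)"
    using g_pos[of _ x] by (metis g_simps(9) order.order_iff_strict)
  also have "\<dots> = g x w w * (g x u u * g x w w - (g x u w)\<^sup>2)"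
    by (simp add: g_simps algebra_simps power2_eq_square g_commute[of x w u])
  finally show ?thesis
    using g_pos[OF False, of x] by (simp add: zero_le_mult_iff)
qed (simp add: g_simps)

context
  fixes t x y
  assumes t: "t \<in> Dom" and t_eq: "t = (x, y)"
begin

lemma slope_pos: "0 < slope x"
  using t by (auto simp: Dom_def slope_def t_eq)

lemma y_nonzero: "y \<noteq> 0"
  using t by (auto simp: Dom_def t_eq)

lemma y_eq: "y = \<xi> t + F t *\<^sub>R W x"
  by (simp add: \<xi>_def t_eq)

lemma radicand_pos: "0 < slope x * g x y y + (g x (W x) y)\<^sup>2"
  using slope_pos g_pos[OF y_nonzero, of x] by (simp add: add_pos_nonneg)

lemma F_eq: "F t = (sqrt (slope x * g x y y + (g x (W x) y)\<^sup>2) - g x (W x) y) / slope x"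
proof -
  have "g x y y / slope x + (g x (W x) y)\<^sup>2 / (slope x)\<^sup>2 = (slope x * g x y y + (g x (W x) y)\<^sup>2) / (slope x)\<^sup>2"
    using slope_pos by (simp add: field_simps power2_eq_square)
  then show ?thesis
    using slope_pos by (simp add: F_def t_eq real_sqrt_divide diff_divide_distrib)
qed

lemma D_eq: "D t = sqrt (slope x * g x y y + (g x (W x) y)\<^sup>2)"
proof -
  have "D t = slope x * F t + g x (W x) y"
    by (simp add: D_def \<xi>_def t_eq slope_def g_simps g_commute[of x y "W x"] algebra_simps)
  also have "\<dots> = sqrt (slope x * g x y y + (g x (W x) y)\<^sup>2)"
    using slope_pos by (simp add: F_eq)
  finally show ?thesis .
qed

lemma D_pos: "0 < D t"
  using radicand_pos by (simp add: D_eq)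

lemma F_pos: "0 < F t"
proof -
  have "g x (W x) y < sqrt (slope x * g x y y + (g x (W x) y)\<^sup>2)"
    using slope_pos g_pos[OF y_nonzero, of x] by (intro real_less_rsqrt) simp
  then show ?thesis
    using slope_pos by (simp add: F_eq)
qed

text \<open>Zermelo's condition that \<open>y / F - W\<close> be a \<open>g\<close>-unit vector,
  cleared of denominators; it comes from squaring the root formula \<open>F_eq\<close>.\<close>

lemma F_quadratic: "slope x * (F t)\<^sup>2 + 2 * F t * g x (W x) y - g x y y = 0"
proof -
  have "(slope x * F t + g x (W x) y)\<^sup>2 = slope x * g x y y + (g x (W x) y)\<^sup>2"
    using slope_pos radicand_pos by (simp add: F_eq)
  then have "slope x * (slope x * (F t)\<^sup>2 + 2 * F t * g x (W x) y - g x y y) = 0"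
    by (simp add: power2_eq_square algebra_simps)
  then show ?thesis
    using slope_pos by simp
qed

lemma g_\<xi>_\<xi>: "g x (\<xi> t) (\<xi> t) = (F t)\<^sup>2"
proof -
  have "g x (\<xi> t) (\<xi> t) = g x y y - 2 * F t * g x (W x) y + (F t)\<^sup>2 * g x (W x) (W x)"
    by (simp add: \<xi>_def t_eq g_simps g_commute[of x y "W x"] algebra_simps power2_eq_square)
  then show ?thesis
    using F_quadratic by (simp add: slope_def algebra_simps)
qed

end

text \<open>Implicit differentiation of \<open>g x (\<xi> t) (\<xi> t) = (F t)\<^sup>2\<close> gives the partial derivatives of \<open>F\<close>, with
  denominator \<open>D t\<close>.\<close>

definition Fx :: "(real ^ 'n) \<times> (real ^ 'n) \<Rightarrow> real ^ 'n \<Rightarrow> real" where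
  "Fx t u = (dg (fst t) u (\<xi> t) (\<xi> t) / 2 - F t * g (fst t) (\<xi> t) (W u)) / D t"

definition Fy :: "(real ^ 'n) \<times> (real ^ 'n) \<Rightarrow> real ^ 'n \<Rightarrow> real" where
  "Fy t u = g (fst t) (\<xi> t) u / D t"

lemma linear_Fx: "linear (Fx t)"
  by (rule linearI)
    (simp_all add: Fx_def g_simps dg_simps W_simps field_simps flip: add_divide_distrib diff_divide_distrib)

lemma linear_Fy: "linear (Fy t)"
  by (rule linearI) (simp_all add: Fy_def g_simps add_divide_distrib)

lemma F_derivative:
  assumes "t \<in> Dom"
  shows "(F has_derivative (\<lambda>d. Fx t (fst d) + Fy t (snd d))) (at t)"
proof -
  obtain x y where t_eq: "t = (x, y)"
    by (cases t)
  note dW = W_derivative[OF has_derivative_fst[OF has_derivative_ident]]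
  note gWW = g_derivative[OF has_derivative_fst[OF has_derivative_ident] dW dW]
  note gWy = g_derivative[OF has_derivative_fst[OF has_derivative_ident] dW
      has_derivative_snd[OF has_derivative_ident]]
  note gyy = g_derivative[OF has_derivative_fst[OF has_derivative_ident]
      has_derivative_snd[OF has_derivative_ident] has_derivative_snd[OF has_derivative_ident]]
  let ?Y = "\<lambda>t. g (fst t) (snd t) (snd t)"
  let ?B = "\<lambda>t. g (fst t) (W (fst t)) (snd t)"
  have slope: "(\<lambda>t. slope (fst t)) = (\<lambda>t. 1 - g (fst t) (W (fst t)) (W (fst t)))"
    by (simp add: slope_def)
  define l' where "l' = (\<lambda>d::(real ^ 'n) \<times> (real ^ 'n). - (dg x (fst d) (W x) (W x) + 2 * g x (W (fst d)) (W x)))"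
  have l': "((\<lambda>t. slope (fst t)) has_derivative l') (at t)"
    unfolding slope l'_def
    by (rule has_derivative_eq_rhs, rule has_derivative_diff[OF has_derivative_const gWW])
      (simp add: t_eq g_commute[of x "W x" "W _"] fun_eq_iff)
  define Y' where "Y' = (\<lambda>d::(real ^ 'n) \<times> (real ^ 'n). dg x (fst d) y y + 2 * g x y (snd d))"
  have Y': "(?Y has_derivative Y') (at t)"
    unfolding Y'_def by (rule has_derivative_eq_rhs, rule gyy) (simp add: t_eq g_commute[of x _ y] fun_eq_iff)
  define B' where "B' = (\<lambda>d. dg x (fst d) (W x) y + g x (W (fst d)) y + g x (W x) (snd d))"
  have B': "(?B has_derivative B') (at t)"
    unfolding B'_def by (rule has_derivative_eq_rhs, rule gWy) (simp add: t_eq)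
  \<comment> \<open>The explicit root formula is used for differentiability only; the value of the
    derivative comes from the quadratic.\<close>
  have "\<exists>F'. (F has_derivative F') (at t)"
  proof -
    have "0 < ?Y t / slope (fst t) + (?B t)\<^sup>2 / (slope (fst t))\<^sup>2" "slope (fst t) \<noteq> 0" "(slope (fst t))\<^sup>2 \<noteq> 0"
      using slope_pos[OF assms t_eq] g_pos[OF y_nonzero[OF assms t_eq], of x]
      by (simp_all add: t_eq add_pos_nonneg)
    then show ?thesis
      unfolding F_def using has_derivative_diff[OF has_derivative_real_sqrt[OF _ has_derivative_add[OF
            has_derivative_divide'[OF Y' l']
            has_derivative_divide'[OF has_derivative_power[OF B'] has_derivative_power[OF l']]]]
          has_derivative_divide'[OF B' l']]
      by blast
  qed
  then obtain F' where F': "(F has_derivative F') (at t)"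
    by blast
  let ?P = "\<lambda>t. slope (fst t) * (F t)\<^sup>2 + 2 * F t * ?B t - ?Y t"
  let ?P' = "\<lambda>d. l' d * (F t)\<^sup>2 + slope x * (2 * F t * F' d) + 2 * F' d * ?B t + 2 * F t * B' d - Y' d"
  have "(?P has_derivative ?P') (at t)"
    by (rule derivative_eq_intros l' F' Y' B' refl)+ (simp add: t_eq fun_eq_iff algebra_simps)
  \<comment> \<open>By \<open>F_quadratic\<close> the function \<open>?P\<close> is zero on the open
    set \<open>Dom\<close>, so \<open>?P'\<close> vanishes; in it \<open>F' d\<close> has the
    coefficient \<open>2 * D t\<close>.\<close>
  moreover have "((\<lambda>t. 0) has_derivative ?P') (at t)"
    by (rule has_derivative_transform_within_open[OF calculation open_Dom assms])
      (metis F_quadratic prod.collapse)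
  then have P': "?P' d = 0" for d
    by (rule fun_cong[OF has_derivative_unique[OF _ has_derivative_const]])
  have "F' d = Fx t (fst d) + Fy t (snd d)" for d
  proof -
    have t_simps: "fst t = x" "snd t = y"
      by (simp_all add: t_eq)
    have D: "D t = slope x * F t + g x (W x) y"
      by (simp add: D_def \<xi>_def t_eq slope_def g_simps g_commute[of x y "W x"] algebra_simps)
    have "2 * D t * F' d = Y' d - 2 * F t * B' d - l' d * (F t)\<^sup>2"
      using P'[of d] unfolding t_simps D by (simp add: algebra_simps)
    also have "\<dots> = dg x (fst d) (\<xi> t) (\<xi> t) - 2 * F t * g x (\<xi> t) (W (fst d)) + 2 * g x (\<xi> t) (snd d)"
      by (simp add: Y'_def B'_def l'_def \<xi>_def t_eq g_simps dg_simps algebra_simps power2_eq_square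
          g_commute[of x "W x" y] g_commute[of x "W x" "W _"] g_commute[of x "W _" y] dg_commute[of x _ "W x" y])
    finally show ?thesis
      using D_pos[OF assms t_eq] by (simp add: Fx_def Fy_def t_eq field_simps)
  qed
  then show ?thesis
    using F' by presburger
qed

text \<open>Here and below the prefix \<open>d\<close> marks the total derivative at \<open>t = (x, y)\<close> in the direction
  \<open>d = (dx, dy)\<close>.\<close>

definition dF :: "(real ^ 'n) \<times> (real ^ 'n) \<Rightarrow> (real ^ 'n) \<times> (real ^ 'n) \<Rightarrow> real" where
  "dF t d = Fx t (fst d) + Fy t (snd d)"

definition d\<xi> :: "(real ^ 'n) \<times> (real ^ 'n) \<Rightarrow> (real ^ 'n) \<times> (real ^ 'n) \<Rightarrow> real ^ 'n" where
  "d\<xi> t d = snd d - dF t d *\<^sub>R W (fst t) - F t *\<^sub>R W (fst d)"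

definition dD :: "(real ^ 'n) \<times> (real ^ 'n) \<Rightarrow> (real ^ 'n) \<times> (real ^ 'n) \<Rightarrow> real" where
  "dD t d = dF t d + dg (fst t) (fst d) (\<xi> t) (W (fst t)) + g (fst t) (d\<xi> t d) (W (fst t))
     + g (fst t) (\<xi> t) (W (fst d))"

definition dFy :: "(real ^ 'n) \<times> (real ^ 'n) \<Rightarrow> real ^ 'n \<Rightarrow> (real ^ 'n) \<times> (real ^ 'n) \<Rightarrow> real" where
  "dFy t u d = (dg (fst t) (fst d) (\<xi> t) u + g (fst t) (d\<xi> t d) u - Fy t u * dD t d) / D t"

text \<open>The vertical derivative of \<open>\<xi>\<close> (see \<open>d\<xi>_snd\<close>).\<close>

definition hat :: "(real ^ 'n) \<times> (real ^ 'n) \<Rightarrow> real ^ 'n \<Rightarrow> real ^ 'n" where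
  "hat t u = u - Fy t u *\<^sub>R W (fst t)"

text \<open>The mixed second derivative of \<open>F\<close>: \<open>w\<close> is the base direction,
  \<open>u\<close> the fibre direction.\<close>

definition Fxy :: "(real ^ 'n) \<times> (real ^ 'n) \<Rightarrow> real ^ 'n \<Rightarrow> real ^ 'n \<Rightarrow> real" where
  "Fxy t w u = (dg (fst t) w (\<xi> t) (hat t u) - Fy t u * g (fst t) (\<xi> t) (W w)
     - F t * g (fst t) (hat t u) (W w) - Fx t w * (Fy t u + g (fst t) (hat t u) (W (fst t)))) / D t"

lemma linear_Fxy: "linear (\<lambda>w. Fxy t w u)"
  unfolding Fxy_def divide_inverse
  by (rule linearI) (simp_all add: g_simps dg_simps W_simps linear_add[OF linear_Fx] linear_scale[OF linear_Fx]
      algebra_simps)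

lemma killing': "dg x (W x) u w = - g x (W u) w - g x u (W w)"
  using killing[of x u w] by linarith

lemma half_dg: "dg x d u u = 2 * g x u (\<Gamma> x u d)"
  by (simp add: metric_compatible g_commute[of x "\<Gamma> x u d" u] \<Gamma>_commute[of x d])

text \<open>The Killing equation in covariant form: as \<open>W\<close> is linear,
  \<open>\<nabla>_u W = W u + \<Gamma> x u (W x)\<close>, and this is \<open>g\<close>-orthogonal to
  \<open>u\<close>.\<close>

lemma g_\<Gamma>_W: "g x u (\<Gamma> x u (W x)) = - g x u (W u)"
  using killing'[of x u u] by (simp add: half_dg g_commute[of x "W u"])

lemma dF_simps: "dF t (u, 0) = Fx t u" "dF t (0, u) = Fy t u"
  by (simp_all add: dF_def linear_0[OF linear_Fx] linear_0[OF linear_Fy])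

lemma d\<xi>_snd: "d\<xi> t (0, u) = hat t u"
  by (simp add: d\<xi>_def dF_simps W_simps hat_def)

lemma linear_hat: "linear (hat t)"
  unfolding hat_def
  by (intro linear_compose_sub linear_ident linear_compose_scale_right linear_Fy)
    (rule linearI, simp_all add: linear_add[OF linear_Fy] linear_scale[OF linear_Fy] algebra_simps)

lemma F_derivative':
  assumes "t \<in> Dom"
  shows "(F has_derivative dF t) (at t)"
  using F_derivative[OF assms] by (simp add: dF_def[abs_def])

lemma \<xi>_derivative:
  assumes "t \<in> Dom"
  shows "(\<xi> has_derivative d\<xi> t) (at t)"
proof -
  have "(\<xi> has_derivative (\<lambda>d. snd d - (F t *\<^sub>R W (fst d) + dF t d *\<^sub>R W (fst t)))) (at t)"
    unfolding \<xi>_def[abs_def]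
    by (intro derivative_intros W_derivative F_derivative' assms)
  then show ?thesis
    by (simp add: d\<xi>_def[abs_def] algebra_simps)
qed

lemma D_derivative:
  assumes "t \<in> Dom"
  shows "(D has_derivative dD t) (at t)"
  unfolding D_def[abs_def]
  by (rule has_derivative_eq_rhs, rule has_derivative_add[OF F_derivative'[OF assms]
        g_derivative[OF has_derivative_fst[OF has_derivative_ident] \<xi>_derivative[OF assms]
          W_derivative[OF has_derivative_fst[OF has_derivative_ident]]]])
    (simp add: dD_def fun_eq_iff)

lemma Fy_derivative:
  assumes "t \<in> Dom"
  shows "((\<lambda>t. Fy t u) has_derivative dFy t u) (at t)"
proof -
  have "D t \<noteq> 0"
    using D_pos[OF assms] by (cases t) force
  then show ?thesis
    unfolding Fy_def
    by (intro has_derivative_eq_rhs[OF has_derivative_divide'[OF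
            g_derivative[OF has_derivative_fst[OF has_derivative_ident] \<xi>_derivative[OF assms]
              has_derivative_const] D_derivative[OF assms]]])
      (auto simp: dFy_def Fy_def g_simps fun_eq_iff field_simps)
qed

section \<open>The fundamental tensor and its positivity\<close>

definition fund :: "(real ^ 'n) \<times> (real ^ 'n) \<Rightarrow> real ^ 'n \<Rightarrow> real ^ 'n \<Rightarrow> real" where
  "fund t u w = Fy t u * Fy t w + F t * (g (fst t) (hat t u) (hat t w) - Fy t u * Fy t w) / D t"

lemma bilinear_fund: "bilinear (fund t)"
  unfolding bilinear_def
  by (auto intro!: linearI simp: fund_def linear_add[OF linear_Fy] linear_scale[OF linear_Fy]
      linear_add[OF linear_hat] linear_scale[OF linear_hat] g_simps algebra_simps add_divide_distrib
      diff_divide_distrib)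

text \<open>With this fibre Hessian of \<open>F\<close>, the form \<open>fund\<close> reads
  \<open>F_y F_y + F F_yy\<close>, half the fibre Hessian of the energy.\<close>

lemma dFy_snd: "dFy t w (0, u) = (g (fst t) (hat t u) (hat t w) - Fy t u * Fy t w) / D t"
proof -
  have "g (fst t) (hat t u) w - Fy t w * dD t (0, u)
      = g (fst t) (hat t u) (hat t w) - Fy t u * Fy t w"
    by (simp add: dD_def d\<xi>_snd dF_simps dg_simps W_simps g_simps)
      (simp add: hat_def[of _ w] g_simps algebra_simps)
  then show ?thesis
    by (simp add: dFy_def d\<xi>_snd dg_simps)
qed

abbreviation Fc :: "real ^ 'n \<Rightarrow> real ^ 'n \<Rightarrow> real" where
  "Fc \<equiv> (\<lambda>x y. F (x, y))"

lemma ddx_energy: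
  assumes "(x, y) \<in> Dom"
  shows "ddx k (energy Fc) x y = 2 * F (x, y) * Fx (x, y) (axis k 1)"
proof -
  have "((\<lambda>t. (F t)\<^sup>2) has_derivative (\<lambda>d. 2 * F (x, y) * dF (x, y) d)) (at (x, y))"
    by (rule has_derivative_eq_rhs, rule has_derivative_power, rule F_derivative'[OF assms]) auto
  from ddx_eq[OF open_Dom assms _ this, of "energy Fc" k] show ?thesis
    by (simp add: energy_def dF_simps)
qed

lemma ddy_energy:
  assumes "(x, y) \<in> Dom"
  shows "ddy k (energy Fc) x y = 2 * F (x, y) * Fy (x, y) (axis k 1)"
proof -
  have "((\<lambda>t. (F t)\<^sup>2) has_derivative (\<lambda>d. 2 * F (x, y) * dF (x, y) d)) (at (x, y))"
    by (rule has_derivative_eq_rhs, rule has_derivative_power, rule F_derivative'[OF assms]) auto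
  from ddy_eq[OF open_Dom assms _ this, of "energy Fc" k] show ?thesis
    by (simp add: energy_def dF_simps)
qed

lemma bilin_fundamental_tensor:
  assumes "(x, y) \<in> Dom"
  shows "bilin (fundamental_tensor Fc x y) u w = fund (x, y) u w"
proof (rule bilin_eq_bilinear[OF bilinear_fund])
  fix i j
  let ?t = "(x, y)"
  have "((\<lambda>t. 2 * F t * Fy t (axis i 1)) has_derivative
      (\<lambda>d. 2 * dF ?t d * Fy ?t (axis i 1) + 2 * F ?t * dFy ?t (axis i 1) d)) (at ?t)"
    by (rule has_derivative_eq_rhs, rule has_derivative_mult[OF has_derivative_mult[OF
            has_derivative_const F_derivative'] Fy_derivative]) (use assms in auto)
  from ddy_eq[OF open_Dom assms _ this, of "ddy i (energy Fc)" j]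
  have "ddy j (ddy i (energy Fc)) x y
      = 2 * dF ?t (0, axis j 1) * Fy ?t (axis i 1) + 2 * F ?t * dFy ?t (axis i 1) (0, axis j 1)"
    using ddy_energy by simp
  then show "fundamental_tensor Fc x y $ i $ j = fund ?t (axis i 1) (axis j 1)"
    by (simp add: fundamental_tensor_def dF_simps dFy_snd fund_def g_commute)
qed

text \<open>Since \<open>F * Fy u = g(\<xi>, hat u)\<close> and
  \<open>g(\<xi>, \<xi>) = F^2\<close>, Cauchy-Schwarz makes both summands of \<open>fund\<close>
  nonnegative. If the first vanishes, then \<open>hat t u = u\<close> and the second is
  \<open>F * g(u, u) / D > 0\<close>.\<close>

lemma fund_pos:
  assumes "t \<in> Dom" "u \<noteq> 0"
  shows "0 < fund t u u"
proof -
  obtain x y where t_eq: "t = (x, y)"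
    by (cases t)
  have pos: "0 < D t" "0 < F t"
    using D_pos F_pos assms(1) t_eq by blast+
  have *: "F t * Fy t u = g x (\<xi> t) (hat t u)"
    using pos by (simp add: hat_def t_eq Fy_def g_simps D_def field_simps)
  have "(F t)\<^sup>2 * (Fy t u)\<^sup>2 \<le> (F t)\<^sup>2 * g x (hat t u) (hat t u)"
    using g_Cauchy_Schwarz[of x "\<xi> t" "hat t u"] g_\<xi>_\<xi>[OF assms(1) t_eq]
    by (simp flip: * add: power_mult_distrib)
  then have le: "(Fy t u)\<^sup>2 \<le> g x (hat t u) (hat t u)"
    using pos by simp
  show ?thesis
  proof (cases "Fy t u = 0")
    case True
    then show ?thesis
      using pos g_pos[OF assms(2), of x] by (simp add: fund_def hat_def t_eq)
  next
    case False
    have "0 \<le> F t * (g x (hat t u) (hat t u) - Fy t u * Fy t u) / D t"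
      using pos le by (simp add: power2_eq_square)
    moreover have "0 < Fy t u * Fy t u"
      using False not_real_square_gt_zero by blast
    ultimately show ?thesis
      by (simp add: fund_def t_eq)
  qed
qed

section \<open>The Euler-Lagrange expression of the energy and the spray\<close>

lemma ddy_ddx_energy:
  assumes "(x, y) \<in> Dom"
  shows "(\<Sum>k\<in>UNIV. ddy l (ddx k (energy Fc)) x y * w $ k)
    = 2 * Fy (x, y) (axis l 1) * Fx (x, y) w + 2 * F (x, y) * Fxy (x, y) w (axis l 1)"
proof -
  let ?t = "(x, y)" and ?e = "axis l 1 :: real ^ 'n"
  let ?S = "(\<lambda>z. (x, z)) -` Dom"
  have S: "open ?S" "y \<in> ?S"
    using assms by (auto intro!: open_vimage open_Dom continuous_intros)
  have inj: "((\<lambda>z. (x, z)) has_derivative (\<lambda>u. (0, u))) (at y)"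
    by (auto intro!: derivative_eq_intros)
  have slice: "((\<lambda>z. f (x, z)) has_derivative (\<lambda>u. f' (0, u))) (at y)"
    if "(f has_derivative f') (at ?t)" for f :: "_ \<Rightarrow> 'c::real_normed_vector" and f'
    by (rule has_derivative_compose[OF inj that])
  have dF: "((\<lambda>z. F (x, z)) has_derivative Fy ?t) (at y)"
    using slice[OF F_derivative'[OF assms]] by (simp add: dF_simps)
  have d\<xi>: "((\<lambda>z. \<xi> (x, z)) has_derivative hat ?t) (at y)"
    using slice[OF \<xi>_derivative[OF assms]] by (simp add: d\<xi>_snd)
  have dD: "((\<lambda>z. D (x, z)) has_derivative (\<lambda>u. Fy ?t u + g x (hat ?t u) (W x))) (at y)"
    using slice[OF D_derivative[OF assms]] by (simp add: dD_def dF_simps d\<xi>_snd dg_simps W_simps g_simps)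
  \<comment> \<open>\<open>dg\<close> is not differentiated in the base point: on the fibre over the
    fixed \<open>x\<close> it is a fixed bilinear form.\<close>
  have dFx: "((\<lambda>z. Fx (x, z) w) has_derivative Fxy ?t w) (at y)" for w
  proof -
    have "D ?t \<noteq> 0"
      using D_pos[OF assms] by simp
    moreover have "bounded_bilinear (dg x w)"
      using bilinear_dg bilinear_conv_bounded_bilinear by blast
    ultimately show ?thesis
      unfolding Fx_def fst_conv
      by (intro has_derivative_eq_rhs[OF has_derivative_divide'[OF has_derivative_diff[OF
              bounded_linear.has_derivative[OF bounded_linear_divide bounded_bilinear.FDERIV[OF _ d\<xi> d\<xi>]]
              has_derivative_mult[OF dF g_derivative[OF has_derivative_const d\<xi> has_derivative_const]]] dD]])
        (auto simp: Fxy_def Fx_def fun_eq_iff dg_simps g_simps dg_commute[of x w "hat _ _" "\<xi> _"] field_simps)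
  qed
  have "ddy l (ddx k (energy Fc)) x y
      = 2 * Fy ?t ?e * Fx ?t (axis k 1) + 2 * F ?t * Fxy ?t (axis k 1) ?e" for k
  proof -
    have "ddy l (ddx k (energy Fc)) x y = pderiv_at l (\<lambda>z. 2 * F (x, z) * Fx (x, z) (axis k 1)) y"
      by (rule pderiv_at_cong_open[OF S]) (simp add: ddx_energy)
    also have "\<dots> = 2 * Fy ?t ?e * Fx ?t (axis k 1) + 2 * F ?t * Fxy ?t (axis k 1) ?e"
      by (rule pderiv_at_eq[OF has_derivative_eq_rhs[OF has_derivative_mult[OF
                has_derivative_mult[OF has_derivative_const dF] dFx]], THEN trans]) auto
    finally show ?thesis .
  qed
  then have "(\<Sum>k\<in>UNIV. ddy l (ddx k (energy Fc)) x y * w $ k)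
      = 2 * Fy ?t ?e * (\<Sum>k\<in>UNIV. w $ k *\<^sub>R Fx ?t (axis k 1))
        + 2 * F ?t * (\<Sum>k\<in>UNIV. w $ k *\<^sub>R Fxy ?t (axis k 1) ?e)"
    by (simp add: sum.distrib sum_distrib_left algebra_simps)
  then show ?thesis
    by (simp only: linear_eq_sum_axis[OF linear_Fx, symmetric] linear_eq_sum_axis[OF linear_Fxy, symmetric])
qed

text \<open>If \<open>\<gamma>\<close> is a unit speed geodesic of \<open>g\<close>, then \<open>exp (s W) (\<gamma> s)\<close> is one of \<open>F\<close>; differentiating twice and using
  the invariance of \<open>\<Gamma>\<close> under \<open>exp (s W)\<close> gives these spray coefficients.\<close>

definition G :: "(real ^ 'n) \<times> (real ^ 'n) \<Rightarrow> real ^ 'n" where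
  "G t = (1/2) *\<^sub>R \<Gamma> (fst t) (\<xi> t) (\<xi> t) - F t *\<^sub>R W (snd t) + ((F t)\<^sup>2 / 2) *\<^sub>R W (W (fst t))"

context
  fixes t x y
  assumes t: "t \<in> Dom" and t_eq: "t = (x, y)"
begin

lemma t_simps: "fst t = x" "snd t = y"
  by (simp_all add: t_eq)

lemma D_times: "D t * Fx t u = dg x u (\<xi> t) (\<xi> t) / 2 - F t * g x (\<xi> t) (W u)"
  "D t * Fy t u = g x (\<xi> t) u"
  using D_pos[OF t t_eq] by (simp_all add: Fx_def Fy_def t_simps)

lemma W_y: "W y = W (\<xi> t) + F t *\<^sub>R W (W x)"
  by (subst y_eq[OF t t_eq]) (simp add: W_simps)

lemma dg_y: "dg x y u w = dg x (\<xi> t) u w - F t * (g x (W u) w + g x u (W w))"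
  by (subst y_eq[OF t t_eq]) (simp add: dg_simps killing' algebra_simps)

text \<open>Conservation of \<open>F\<close> along the claimed spray: the derivative of
  \<open>F\<close> in direction \<open>(y, - 2 G)\<close> is \<open>Fx y - 2 Fy G\<close>. The
  Killing equation (through \<open>dg_y\<close>) replaces the derivative of \<open>g\<close> along
  \<open>W x\<close>.\<close>

lemma Fx_y: "Fx t y = 2 * Fy t (G t)"
proof -
  have "D t * Fx t y = dg x (\<xi> t) (\<xi> t) (\<xi> t) / 2 - F t * (g x (\<xi> t) (W (\<xi> t)) + g x (\<xi> t) (W y))"
    by (simp add: D_times dg_y g_commute[of x "W (\<xi> t)" "\<xi> t"] field_simps)
  also have "\<dots> = 2 * g x (\<xi> t) (G t)"
    by (simp add: G_def t_simps g_simps half_dg W_y power2_eq_square algebra_simps)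
  also have "\<dots> = D t * (2 * Fy t (G t))"
    by (simp add: D_times mult.left_commute[of "D t" 2])
  finally show ?thesis
    using D_pos[OF t t_eq] by simp
qed

text \<open>The claimed spray \<open>G\<close>, with its index lowered by \<open>fund\<close>, must
  give the Euler-Lagrange expression of the energy. The rank-one part of \<open>fund\<close> yields
  the first summand by \<open>Fx_y\<close>; the rest reduces to \<open>main\<close>, an identity in
  \<open>\<xi>\<close> and \<open>hat t u\<close> that comes from metric compatibility and the
  Killing equation.\<close>

lemma euler_lagrange: "2 * fund t (G t) u = Fy t u * Fx t y + F t * Fxy t y u - F t * Fx t u"
proof -
  let ?v = "W x" and ?u = "hat t u"
  have "dg x y (\<xi> t) ?u = g x (\<Gamma> x (\<xi> t) (\<xi> t)) ?u + g x (\<xi> t) (\<Gamma> x (\<xi> t) ?u)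
      - F t * (g x (W (\<xi> t)) ?u + g x (\<xi> t) (W ?u))"
    by (simp add: dg_y metric_compatible[of x "\<xi> t"])
  moreover have "dg x u (\<xi> t) (\<xi> t) / 2 = g x (\<xi> t) (\<Gamma> x (\<xi> t) ?u) - Fy t u * g x (\<xi> t) (W (\<xi> t))"
    by (simp add: half_dg hat_def t_simps \<Gamma>_simps g_simps g_\<Gamma>_W)
  moreover have "2 * g x (G t) ?u = g x (\<Gamma> x (\<xi> t) (\<xi> t)) ?u - 2 * F t * g x (W y) ?u
      + (F t)\<^sup>2 * g x (W ?v) ?u"
    by (simp add: G_def t_simps g_simps)
  moreover have "W u = W ?u + Fy t u *\<^sub>R W ?v"
    by (simp add: hat_def t_simps W_simps)
  ultimately have main: "2 * g x (G t) ?u = dg x y (\<xi> t) ?u - Fy t u * g x (\<xi> t) (W y)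
      - F t * g x ?u (W y) - (dg x u (\<xi> t) (\<xi> t) / 2 - F t * g x (\<xi> t) (W u))"
    by (simp add: W_y g_simps power2_eq_square algebra_simps g_commute[of x ?u "W _"])
  have "g x (hat t (G t)) ?u = g x (G t) ?u - Fy t (G t) * g x ?u ?v"
    by (simp add: hat_def[of t "G t"] t_simps g_simps g_commute[of x ?v ?u])
  moreover have "D t * Fxy t y u = dg x y (\<xi> t) ?u - Fy t u * g x (\<xi> t) (W y) - F t * g x ?u (W y)
      - 2 * Fy t (G t) * (Fy t u + g x ?u ?v)"
    using D_pos[OF t t_eq] by (simp add: Fxy_def t_simps Fx_y)
  ultimately have "D t * (Fxy t y u - Fx t u) = 2 * (g x (hat t (G t)) ?u - Fy t (G t) * Fy t u)"
    using main D_times(1)[of u] by (simp add: algebra_simps)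
  then have "Fxy t y u - Fx t u = 2 * ((g x (hat t (G t)) ?u - Fy t (G t) * Fy t u) / D t)"
    using D_pos[OF t t_eq] by (simp add: field_simps)
  then have "F t * (Fxy t y u - Fx t u) = 2 * (F t * (g x (hat t (G t)) ?u - Fy t (G t) * Fy t u) / D t)"
    by simp
  moreover have "F t * Fxy t y u - F t * Fx t u = F t * (Fxy t y u - Fx t u)"
    by (simp add: right_diff_distrib)
  ultimately show ?thesis
    by (simp add: fund_def t_simps Fx_y)
qed

end

text \<open>By \<open>euler_lagrange\<close> the bracket in the spray is four times the fundamental
  tensor applied to \<open>G\<close>; positivity makes that tensor invertible, so
  \<open>matrix_inv\<close> cancels it.\<close>

lemma spray_eq:
  assumes "(x, y) \<in> Dom"
  shows "spray Fc i x y = G (x, y) $ i"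
proof -
  let ?t = "(x, y)" and ?A = "fundamental_tensor Fc x y"
  have "invertible ?A"
    using fund_pos[OF assms] bilin_fundamental_tensor[OF assms]
    by (intro invertible_if_pos_def) simp
  have "(\<Sum>k\<in>UNIV. ddy l (ddx k (energy Fc)) x y * y $ k) - ddx l (energy Fc) x y
      = 4 * (?A *v G ?t) $ l" for l
  proof -
    have "(?A *v G ?t) $ l = bilin ?A (axis l 1) (G ?t)"
      by (simp add: bilin_def inner_axis')
    also have "\<dots> = fund ?t (G ?t) (axis l 1)"
      by (simp add: bilin_fundamental_tensor[OF assms]) (simp add: fund_def g_commute)
    finally show ?thesis
      using euler_lagrange[OF assms refl, of "axis l 1"]
      by (simp add: ddy_ddx_energy[OF assms] ddx_energy[OF assms])
  qed
  then have "spray Fc i x y = (matrix_inv ?A *v (?A *v G ?t)) $ i"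
    by (simp add: spray_def matrix_vector_mult_def[of "matrix_inv _"] sum_distrib_left)
  also have "\<dots> = G ?t $ i"
    using \<open>invertible ?A\<close> by (simp add: matrix_vector_mul_assoc matrix_inv_mult)
  finally show ?thesis .
qed

section \<open>The nonlinear connection (the vertical derivative \<open>Gy\<close> of
  \<open>G\<close>) and the Riemann tensor\<close>

definition Gy :: "(real ^ 'n) \<times> (real ^ 'n) \<Rightarrow> real ^ 'n \<Rightarrow> real ^ 'n" where
  "Gy t u = \<Gamma> (fst t) (\<xi> t) u - F t *\<^sub>R W u - Fy t u *\<^sub>R (\<Gamma> (fst t) (\<xi> t) (W (fst t)) + W (\<xi> t))"

definition dG :: "(real ^ 'n) \<times> (real ^ 'n) \<Rightarrow> (real ^ 'n) \<times> (real ^ 'n) \<Rightarrow> real ^ 'n" where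
  "dG t d = (1/2) *\<^sub>R d\<Gamma> (fst t) (fst d) (\<xi> t) (\<xi> t) + \<Gamma> (fst t) (\<xi> t) (d\<xi> t d)
     - dF t d *\<^sub>R W (snd t) - F t *\<^sub>R W (snd d)
     + (F t * dF t d) *\<^sub>R W (W (fst t)) + ((F t)\<^sup>2 / 2) *\<^sub>R W (W (fst d))"

definition dGy :: "(real ^ 'n) \<times> (real ^ 'n) \<Rightarrow> real ^ 'n \<Rightarrow> (real ^ 'n) \<times> (real ^ 'n) \<Rightarrow> real ^ 'n" where
  "dGy t u d = d\<Gamma> (fst t) (fst d) (\<xi> t) u + \<Gamma> (fst t) (d\<xi> t d) u - dF t d *\<^sub>R W u
     - dFy t u d *\<^sub>R (\<Gamma> (fst t) (\<xi> t) (W (fst t)) + W (\<xi> t))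
     - Fy t u *\<^sub>R (d\<Gamma> (fst t) (fst d) (\<xi> t) (W (fst t)) + \<Gamma> (fst t) (d\<xi> t d) (W (fst t))
         + \<Gamma> (fst t) (\<xi> t) (W (fst d)) + W (d\<xi> t d))"

lemma G_derivative:
  assumes "t \<in> Dom"
  shows "(G has_derivative dG t) (at t)"
proof -
  note fst = has_derivative_fst[OF has_derivative_ident]
  note W_snd = W_derivative[OF has_derivative_snd[OF has_derivative_ident]]
  show ?thesis
    unfolding G_def[abs_def]
    by (rule has_derivative_eq_rhs, rule has_derivative_add[OF has_derivative_diff[OF
            has_derivative_scaleR_right[OF \<Gamma>_derivative[OF fst \<xi>_derivative \<xi>_derivative]]
            has_derivative_scaleR[OF F_derivative' W_snd]]
          has_derivative_scaleR[OF bounded_linear.has_derivative[OF bounded_linear_divide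
              has_derivative_power[OF F_derivative']] W_derivative[OF W_derivative[OF fst]]]])
      (use assms in \<open>auto simp: dG_def fun_eq_iff \<Gamma>_commute[of _ "d\<xi> _ _"] algebra_simps
         simp flip: scaleR_left_distrib\<close>)
qed

lemma Gy_derivative:
  assumes "t \<in> Dom"
  shows "((\<lambda>t. Gy t u) has_derivative dGy t u) (at t)"
proof -
  note fst = has_derivative_fst[OF has_derivative_ident]
  note \<xi>' = \<xi>_derivative[OF assms]
  show ?thesis
    unfolding Gy_def[abs_def]
    by (rule has_derivative_eq_rhs, rule has_derivative_diff[OF has_derivative_diff[OF
            \<Gamma>_derivative[OF fst \<xi>' has_derivative_const]
            has_derivative_scaleR_left[OF F_derivative'[OF assms]]]
          has_derivative_scaleR[OF Fy_derivative[OF assms] has_derivative_add[OF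
              \<Gamma>_derivative[OF fst \<xi>' W_derivative[OF fst]] W_derivative[OF \<xi>']]]])
      (auto simp: dGy_def fun_eq_iff \<Gamma>_simps algebra_simps)
qed

lemma dG_snd: "dG t (0, u) = Gy t u"
proof -
  have "W (snd t) = W (\<xi> t) + F t *\<^sub>R W (W (fst t))"
    by (simp add: \<xi>_def W_simps)
  then show ?thesis
    by (simp add: dG_def Gy_def d\<Gamma>_simps d\<xi>_snd dF_simps W_simps hat_def \<Gamma>_simps algebra_simps)
qed

text \<open>The Jacobi operator of \<open>g\<close>: \<open>R(u, e) e\<close> for the Levi-Civita
  curvature in coordinates.\<close>

definition R :: "real ^ 'n \<Rightarrow> real ^ 'n \<Rightarrow> real ^ 'n \<Rightarrow> real ^ 'n" where
  "R x e u = d\<Gamma> x u e e - d\<Gamma> x e e u + \<Gamma> x (\<Gamma> x e e) u - \<Gamma> x e (\<Gamma> x e u)"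

lemma linear_R: "linear (R x e)"
  by (rule linearI) (simp_all add: R_def \<Gamma>_simps d\<Gamma>_simps algebra_simps)

lemma d\<Gamma>_W: "d\<Gamma> x (W x) u w = W (\<Gamma> x u w) - \<Gamma> x (W u) w - \<Gamma> x u (W w)"
  using \<Gamma>_equivariant[of x u w] by (simp add: algebra_simps)

context
  fixes t x y
  assumes t: "t \<in> Dom" and t_eq: "t = (x, y)"
begin

text \<open>The direction \<open>(y, - 2 G)\<close> is the geodesic vector field of \<open>F\<close>.\<close>

lemma dF_spray: "dF t (y, - (2 *\<^sub>R G t)) = 0"
  by (simp add: dF_def Fx_y[OF t t_eq] linear_scale[OF linear_Fy] linear_neg[OF linear_Fy])

text \<open>The geodesic equation of \<open>g\<close> for \<open>\<xi>\<close>, plus the drift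
  caused by the flow of \<open>W\<close> run at rate \<open>F\<close>.\<close>

lemma d\<xi>_spray: "d\<xi> t (y, - (2 *\<^sub>R G t)) = F t *\<^sub>R W (\<xi> t) - \<Gamma> x (\<xi> t) (\<xi> t)"
  unfolding d\<xi>_def dF_spray
  by (simp add: G_def t_simps[OF t t_eq] W_y[OF t t_eq] power2_eq_square vec_eq_iff algebra_simps)

text \<open>The Euler-Lagrange equation \<open>(F_y)' = F_x\<close> along geodesics, on which
  \<open>F\<close> is constant.\<close>

lemma dFy_spray: "dFy t u (y, - (2 *\<^sub>R G t)) = Fx t u"
proof -
  have "dg x y (\<xi> t) u + g x (d\<xi> t (y, - (2 *\<^sub>R G t))) u = D t * Fx t u" for u
    by (simp only: d\<xi>_spray) (simp add: D_times[OF t t_eq] dg_y[OF t t_eq] metric_compatible[of x "\<xi> t"] half_dg g_simps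
        algebra_simps)
  \<comment> \<open>\<open>D\<close> is a first integral: \<open>F\<close> is conserved, and
    \<open>g(\<xi>, W)\<close> is the Noether integral of the Killing field.\<close>
  moreover from this[of "W x"] have "dD t (y, - (2 *\<^sub>R G t)) = 0"
    by (simp add: dD_def dF_spray t_simps[OF t t_eq] D_times[OF t t_eq] W_y[OF t t_eq] half_dg g_simps g_\<Gamma>_W)
  ultimately show ?thesis
    using D_pos[OF t t_eq] by (simp add: dFy_def t_simps[OF t t_eq])
qed

text \<open>Constancy of \<open>F\<close> in horizontal directions, where
  \<open>(u, - Gy t u)\<close> is the horizontal lift of \<open>u\<close>.\<close>

lemma Fy_Gy: "Fy t (Gy t u) = Fx t u"
proof -
  have "D t * Fy t (Gy t u) = D t * Fx t u"
    by (simp add: D_times[OF t t_eq] Gy_def t_simps[OF t t_eq] half_dg g_simps g_\<Gamma>_W)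
  then show ?thesis
    using D_pos[OF t t_eq] by simp
qed

text \<open>In the Riemann formula the two middle sums combine into minus the derivative of
  \<open>Gy t u\<close> along the spray. Equivariance of \<open>\<Gamma>\<close> cancels the terms
  produced by the flow and leaves the curvature of \<open>g\<close>; by linearity the right side is
  \<open>R x (\<xi> t) (hat t u)\<close>.\<close>

lemma jacobi_endomorphism:
  "2 *\<^sub>R dG t (u, 0) - dGy t u (y, - (2 *\<^sub>R G t)) - Gy t (Gy t u) = R x (\<xi> t) u - Fy t u *\<^sub>R R x (\<xi> t) (W x)"
proof -
  have dG: "2 *\<^sub>R dG t (u, 0) = d\<Gamma> x u (\<xi> t) (\<xi> t) - (2 * F t) *\<^sub>R \<Gamma> x (\<xi> t) (W u) + (F t)\<^sup>2 *\<^sub>R W (W u)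
      - (2 * Fx t u) *\<^sub>R (\<Gamma> x (\<xi> t) (W x) + W (\<xi> t))"
    by (simp add: dG_def d\<xi>_def dF_simps t_simps[OF t t_eq] W_y[OF t t_eq] W_simps \<Gamma>_simps
        vec_eq_iff power2_eq_square algebra_simps)
  \<comment> \<open>The direction is split as \<open>y = \<xi> + F W x\<close>; along
    \<open>W x\<close> the derivative of \<open>\<Gamma>\<close> is algebraic by
    equivariance.\<close>
  have dy: "d\<Gamma> x y (\<xi> t) w = d\<Gamma> x (\<xi> t) (\<xi> t) w
      + F t *\<^sub>R (W (\<Gamma> x (\<xi> t) w) - \<Gamma> x (W (\<xi> t)) w - \<Gamma> x (\<xi> t) (W w))" for w
    by (subst y_eq[OF t t_eq]) (simp add: d\<Gamma>_simps d\<Gamma>_W)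
  have dGy: "dGy t u (y, - (2 *\<^sub>R G t)) = d\<Gamma> x y (\<xi> t) u + \<Gamma> x (F t *\<^sub>R W (\<xi> t) - \<Gamma> x (\<xi> t) (\<xi> t)) u
      - Fx t u *\<^sub>R (\<Gamma> x (\<xi> t) (W x) + W (\<xi> t))
      - Fy t u *\<^sub>R (d\<Gamma> x y (\<xi> t) (W x) + \<Gamma> x (F t *\<^sub>R W (\<xi> t) - \<Gamma> x (\<xi> t) (\<xi> t)) (W x)
         + \<Gamma> x (\<xi> t) (W y) + W (F t *\<^sub>R W (\<xi> t) - \<Gamma> x (\<xi> t) (\<xi> t)))"
    by (simp only: dGy_def dF_spray d\<xi>_spray dFy_spray t_simps[OF t t_eq] fst_conv) simp
  have GyGy: "Gy t (Gy t u) = \<Gamma> x (\<xi> t) (Gy t u) - F t *\<^sub>R W (Gy t u)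
      - Fx t u *\<^sub>R (\<Gamma> x (\<xi> t) (W x) + W (\<xi> t))"
    by (simp add: Gy_def[of t "Gy t u"] Fy_Gy t_simps[OF t t_eq])
  have eq: "W (\<Gamma> x (\<xi> t) (\<xi> t)) = d\<Gamma> x (W x) (\<xi> t) (\<xi> t) + 2 *\<^sub>R \<Gamma> x (\<xi> t) (W (\<xi> t))"
    using \<Gamma>_equivariant[of x "\<xi> t" "\<xi> t", symmetric]
    by (simp add: \<Gamma>_commute[of x "W (\<xi> t)"] scaleR_2 add.assoc)
  show ?thesis
    unfolding dG dGy GyGy dy R_def
    by (simp add: Gy_def t_simps[OF t t_eq] W_y[OF t t_eq] W_simps \<Gamma>_simps eq \<Gamma>_commute[of x "W (\<xi> t)" "\<xi> t"])
     (simp add: vec_eq_iff power2_eq_square algebra_simps)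
qed

end

lemma riemann_eq:
  assumes "(x, y) \<in> Dom"
  shows "riemann Fc x y *v u = R x (\<xi> (x, y)) u - Fy (x, y) u *\<^sub>R R x (\<xi> (x, y)) (W x)"
proof (rule matrix_mult_eq_linear)
  show "linear (\<lambda>u. R x (\<xi> (x, y)) u - Fy (x, y) u *\<^sub>R R x (\<xi> (x, y)) (W x))"
    by (rule linearI) (simp_all add: linear_add[OF linear_R] linear_scale[OF linear_R]
        linear_add[OF linear_Fy] linear_scale[OF linear_Fy] algebra_simps)
next
  fix i k
  let ?t = "(x, y)" and ?e = "axis k 1 :: real ^ 'n"
  have comp: "((\<lambda>t. f t $ i) has_derivative (\<lambda>d. f' d $ i)) (at t)"
    if "(f has_derivative f') (at t)" for f' i t and f :: "(real ^ 'n) \<times> (real ^ 'n) \<Rightarrow> real ^ 'n"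
    using that by (rule bounded_linear.has_derivative[OF bounded_linear_vec_nth])
  have spray: "spray Fc i z w = (\<lambda>t. G t $ i) (z, w)" if "(z, w) \<in> Dom" for i z w
    using spray_eq[OF that] by simp
  have x: "ddx k (spray Fc i) x y = dG ?t (axis k 1, 0) $ i" for i k
    using ddx_eq[OF open_Dom assms spray comp[OF G_derivative[OF assms]]] .
  have y: "ddy k (spray Fc i) z w = (\<lambda>t. Gy t (axis k 1) $ i) (z, w)" if "(z, w) \<in> Dom" for i k z w
    using ddy_eq[OF open_Dom that spray comp[OF G_derivative[OF that]]] by (simp add: dG_snd)
  have xy: "ddx j (ddy k (spray Fc i)) x y = dGy ?t ?e (axis j 1, 0) $ i" for i j
    using ddx_eq[OF open_Dom assms y comp[OF Gy_derivative[OF assms]]] .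
  have yy: "ddy j (ddy k (spray Fc i)) x y = dGy ?t ?e (0, axis j 1) $ i" for i j
    using ddy_eq[OF open_Dom assms y comp[OF Gy_derivative[OF assms]]] .
  have lin: "linear (dGy ?t ?e)"
    using has_derivative_linear[OF Gy_derivative[OF assms]] .
  \<comment> \<open>Restricting \<open>dGy\<close> to base and to fibre directions turns the
    coordinate sums of \<open>riemann\<close> into its values at \<open>(y, 0)\<close> and
    \<open>(0, G)\<close>.\<close>
  have "linear (\<lambda>w::real ^ 'n. (w, 0::real ^ 'n))" "linear (\<lambda>w::real ^ 'n. (0::real ^ 'n, w))"
    by (auto intro!: linearI)
  note this[THEN linear_compose[OF _ lin],
      THEN linear_compose[OF _ bounded_linear.linear[OF bounded_linear_vec_nth[of i]]], unfolded o_def]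
  note sums = linear_eq_sum_axis[OF this(1), of y] linear_eq_sum_axis[OF this(2), of "G ?t"]
  have "dGy ?t ?e (y, - (2 *\<^sub>R G ?t)) = dGy ?t ?e (y, 0) - 2 *\<^sub>R dGy ?t ?e (0, G ?t)"
    by (simp flip: linear_diff[OF lin] linear_scale[OF lin])
  moreover have "linear (\<lambda>w. Gy ?t w $ i)"
    by (rule linearI) (simp_all add: Gy_def \<Gamma>_simps W_simps linear_add[OF linear_Fy] linear_scale[OF linear_Fy]
        algebra_simps)
  note linear_eq_sum_axis[OF this, of "Gy ?t ?e"]
  ultimately have "riemann Fc x y $ i $ k
      = (2 *\<^sub>R dG ?t (?e, 0) - dGy ?t ?e (y, - (2 *\<^sub>R G ?t)) - Gy ?t (Gy ?t ?e)) $ i"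
    using assms by (simp add: riemann_def x y xy yy spray sums mult.commute sum_distrib_left)
  then show "riemann Fc x y $ i $ k
      = (R x (\<xi> (x, y)) (axis k 1) - Fy (x, y) (axis k 1) *\<^sub>R R x (\<xi> (x, y)) (W x)) $ i"
    by (simp only: jacobi_endomorphism[OF assms refl])
qed

section \<open>Consequences for the Randers metric: Finsler property, Ricci and flag
  curvature\<close>

lemma randers_of_navigation_eq:
  assumes "\<And>x u w. bilin (A x) u w = g x u w"
  shows "randers_of_navigation A W x y = F (x, y)"
proof -
  have V: "(A x *v W x) \<bullet> y = g x (W x) y" for y
    using assms[of x y "W x"] by (simp add: bilin_def inner_commute g_commute)
  \<comment> \<open>\<open>metric_norm\<close> is a square root, and squaring it returns the
    quadratic form only where that form is nonnegative.\<close>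
  have "0 \<le> g x (W x) (W x)"
    using g_pos[of "W x" x] by (cases "W x = 0") (auto simp: g_simps)
  then have l: "1 - (metric_norm (A x) (W x))\<^sup>2 = slope x"
    by (simp add: metric_norm_def assms slope_def)
  have "bilin (navigation_alpha A W x) y y = g x y y / slope x + (g x (W x) y)\<^sup>2 / (slope x)\<^sup>2"
  proof (rule trans[OF bilin_eq_bilinear])
    let ?B = "\<lambda>u w. g x u w / slope x + g x (W x) u * g x (W x) w / (slope x)\<^sup>2"
    show "bilinear ?B"
      unfolding bilinear_def by (auto intro!: linearI simp: g_simps algebra_simps add_divide_distrib)
    have "A x $ i $ j = g x (axis i 1) (axis j 1)" for i j
      by (simp flip: assms add: bilin_def inner_axis' matrix_vector_mult_basis column_def)
    moreover have "(A x *v W x) $ i = g x (W x) (axis i 1)" for i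
      by (simp flip: V add: inner_axis)
    ultimately show "navigation_alpha A W x $ i $ j = ?B (axis i 1) (axis j 1)" for i j
      by (simp add: navigation_alpha_def Let_def l)
  qed (simp add: power2_eq_square)
  moreover have "navigation_beta A W x \<bullet> y = - (g x (W x) y / slope x)"
  proof -
    have "navigation_beta A W x = (- (1 / slope x)) *\<^sub>R (A x *v W x)"
      by (simp add: navigation_beta_def Let_def l vec_eq_iff)
    then show ?thesis
      by (simp add: V)
  qed
  ultimately show ?thesis
    by (simp add: randers_of_navigation_def metric_norm_def F_def)
qed

lemma F_scaleR:
  assumes "0 < c"
  shows "F (x, c *\<^sub>R y) = c * F (x, y)"
proof -
  have "g x (c *\<^sub>R y) (c *\<^sub>R y) / slope x + (g x (W x) (c *\<^sub>R y))\<^sup>2 / (slope x)\<^sup>2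
      = c\<^sup>2 * (g x y y / slope x + (g x (W x) y)\<^sup>2 / (slope x)\<^sup>2)"
    by (simp add: g_simps power2_eq_square algebra_simps)
  then show ?thesis
    using assms by (simp add: F_def real_sqrt_mult g_simps right_diff_distrib)
qed

lemma finsler_metric:
  assumes "open M" "M \<subseteq> {x. g x (W x) (W x) < 1}"
    and "smooth_on (M \<times> (UNIV - {0})) (\<lambda>t. g (fst t) (snd t) (snd t))"
    and "smooth_on (M \<times> (UNIV - {0})) (\<lambda>t. g (fst t) (W (fst t)) (snd t))"
    and "smooth_on (M \<times> (UNIV - {0 :: real ^ 'n})) (\<lambda>t. slope (fst t))"
  shows "finsler_metric_on M Fc"
proof -
  have dom: "(x, y) \<in> Dom" if "x \<in> M" "y \<noteq> 0" for x y :: "real ^ 'n"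
    using assms(2) that by (auto simp: Dom_def)
  have "smooth_on (M \<times> (UNIV - {0})) F"
    unfolding F_def[abs_def] power2_eq_square
  proof (intro smooth_on_diff smooth_on_sqrt smooth_on_add smooth_on_divide smooth_on_mult assms)
    fix t :: "(real ^ 'n) \<times> (real ^ 'n)"
    assume "t \<in> M \<times> (UNIV - {0})"
    then obtain x y where xy: "t = (x, y)" "x \<in> M" "y \<noteq> 0"
      by auto
    then have "0 < slope x" "0 < g x y y"
      using slope_pos[OF dom refl] g_pos by auto
    then show "slope (fst t) \<noteq> 0" "slope (fst t) \<noteq> 0" "slope (fst t) * slope (fst t) \<noteq> 0"
      "0 < g (fst t) (snd t) (snd t) / slope (fst t)
        + g (fst t) (W (fst t)) (snd t) * g (fst t) (W (fst t)) (snd t) / (slope (fst t) * slope (fst t))"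
      by (simp_all add: xy(1) add_pos_nonneg)
  qed
  \<comment> \<open>The zero vector lies outside \<open>Dom\<close>; there the formula itself gives
    \<open>F = 0\<close>.\<close>
  moreover have "0 \<le> F (x, y)" if "x \<in> M" for x y :: "real ^ 'n"
    using F_pos[OF dom refl] that by (cases "y = 0") (auto simp: F_def g_simps intro: less_imp_le)
  ultimately show ?thesis
    using assms(1) dom bilin_fundamental_tensor fund_pos by (simp add: finsler_metric_on_def F_scaleR)
qed

text \<open>The correction term in \<open>riemann_eq\<close> is a rank-one map
  \<open>u \<mapsto> Fy u * v\<close>; its trace \<open>Fy v\<close> is a multiple of
  \<open>g(\<xi>, v)\<close>, and \<open>v\<close> lies in the image of the Jacobi operator.\<close>

lemma ricci_eq_0:
  assumes "(x, y) \<in> Dom"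
    and "(\<Sum>k\<in>UNIV. R x (\<xi> (x, y)) (axis k 1) $ k) = 0"
    and "\<And>u. g x (\<xi> (x, y)) (R x (\<xi> (x, y)) u) = 0"
  shows "ricci Fc x y = 0"
proof -
  let ?t = "(x, y)" and ?v = "R x (\<xi> (x, y)) (W x)"
  have "ricci Fc x y = (\<Sum>k\<in>UNIV. (riemann Fc x y *v axis k 1) $ k)"
    by (simp add: ricci_def trace_def matrix_vector_mult_basis column_def)
  also have "\<dots> = - (\<Sum>k\<in>UNIV. ?v $ k *\<^sub>R Fy ?t (axis k 1))"
    by (simp add: riemann_eq[OF assms(1)] sum_subtractf assms(2) mult.commute)
  also have "\<dots> = - Fy ?t ?v"
    by (simp only: linear_eq_sum_axis[OF linear_Fy, symmetric])
  also have "\<dots> = 0"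
    by (simp add: Fy_def assms(3))
  finally show ?thesis .
qed

text \<open>Without wind \<open>\<xi> = y\<close>, \<open>hat\<close> is the identity and
  \<open>D = F\<close>, so \<open>fund\<close> collapses to \<open>g\<close>.\<close>

lemma flag_curvature_at_fixed_point:
  assumes "W x = 0" "y \<noteq> 0"
  shows "flag_curvature Fc x y u = g x (R x y u) u / (g x y y * g x u u - (g x y u)\<^sup>2)"
proof -
  have dom: "(x, y) \<in> Dom"
    using assms by (simp add: Dom_def g_simps)
  have \<xi>: "\<xi> (x, y) = y"
    by (simp add: \<xi>_def assms)
  have "R x y 0 = 0"
    using linear_0[OF linear_R] .
  moreover have "fund (x, y) u w = g x u w" for u w
    using F_pos[OF dom refl] by (simp add: fund_def hat_def D_def assms g_simps)
  ultimately show ?thesis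
    by (simp add: flag_curvature_def Let_def bilin_fundamental_tensor[OF dom] riemann_eq[OF dom] \<xi> assms)
qed

end

section \<open>The Levi-Civita connection of the Taub-NUT metric\<close>

abbreviation J :: "real ^ 4 \<Rightarrow> real ^ 4" where
  "J \<equiv> taub_nut_form"

lemma vector_4:
  "(vector [a, b, c, d] :: real ^ 4) $ 1 = a" "(vector [a, b, c, d] :: real ^ 4) $ 2 = b"
  "(vector [a, b, c, d] :: real ^ 4) $ 3 = c" "(vector [a, b, c, d] :: real ^ 4) $ 4 = d"
  unfolding vector_def by simp_all

lemma J_nth: "J x $ 1 = - x $ 2" "J x $ 2 = x $ 1" "J x $ 3 = - x $ 4" "J x $ 4 = x $ 3"
  by (simp_all add: taub_nut_form_def vector_4)

lemma wind_nth: "wind r x $ 1 = r * x $ 4" "wind r x $ 2 = - (r * x $ 3)"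
  "wind r x $ 3 = r * x $ 2" "wind r x $ 4 = - (r * x $ 1)"
  by (simp_all add: wind_def vector_4)

lemma linear_J: "linear J"
  by (rule linearI) (simp_all add: vec_eq_iff forall_4 J_nth)

lemma linear_wind: "linear (wind r)"
  by (rule linearI) (simp_all add: vec_eq_iff forall_4 wind_nth algebra_simps)

lemmas J_simps = linear_simps[OF linear_J]

lemmas wind_simps = linear_simps[OF linear_wind]

lemma J_J: "J (J x) = - x"
  by (simp add: vec_eq_iff forall_4 J_nth)

lemma inner_J: "J u \<bullet> w = - (u \<bullet> J w)" "u \<bullet> J u = 0"
  by (simp_all add: inner_vec_def sum_4 J_nth)

text \<open>With \<open>x\<close> read as a quaternion, \<open>J\<close> is left multiplication by
  \<open>i\<close> and \<open>wind r\<close> right multiplication by \<open>- r k\<close>; the two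
  commute by associativity.\<close>

lemma J_wind: "J (wind r x) = wind r (J x)"
  by (simp add: vec_eq_iff forall_4 J_nth wind_nth)

lemma inner_wind: "wind r u \<bullet> w = - (u \<bullet> wind r w)" "u \<bullet> wind r u = 0"
  by (simp_all add: inner_vec_def sum_4 wind_nth algebra_simps)

text \<open>The inverse of the conformal factor; the coefficient of \<open>\<omega>^2\<close> in
  \<open>g_a\<close> becomes \<open>- a * (1 + lapse a x)\<close>. As a variable subject to
  \<open>lapse_eq\<close> it makes metric and connection polynomial.\<close>

definition lapse :: "real \<Rightarrow> real ^ 4 \<Rightarrow> real" where
  "lapse a x = inverse (a * (x \<bullet> x) + 1)"

definition tn_metric :: "real \<Rightarrow> real ^ 4 \<Rightarrow> real ^ 4 \<Rightarrow> real ^ 4 \<Rightarrow> real" where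
  "tn_metric a x u w = (a * (x \<bullet> x) + 1) * (u \<bullet> w) - a * (1 + lapse a x) * (J x \<bullet> u) * (J x \<bullet> w)"

definition dlapse :: "real \<Rightarrow> real ^ 4 \<Rightarrow> real ^ 4 \<Rightarrow> real" where
  "dlapse a x d = - 2 * a * (x \<bullet> d) * (lapse a x)\<^sup>2"

definition tn_dmetric :: "real \<Rightarrow> real ^ 4 \<Rightarrow> real ^ 4 \<Rightarrow> real ^ 4 \<Rightarrow> real ^ 4 \<Rightarrow> real" where
  "tn_dmetric a x d u w = 2 * a * (x \<bullet> d) * (u \<bullet> w) - a * dlapse a x d * (J x \<bullet> u) * (J x \<bullet> w)
     - a * (1 + lapse a x) * ((J d \<bullet> u) * (J x \<bullet> w) + (J x \<bullet> u) * (J d \<bullet> w))"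

text \<open>The vector \<open>lapse a x *\<^sub>R chris a x u w\<close> is the Christoffel symbol; the Euler--Lagrange equation of the metric yields
  it after the inner product with \<open>J x\<close> has been solved for.\<close>

definition chris :: "real \<Rightarrow> real ^ 4 \<Rightarrow> real ^ 4 \<Rightarrow> real ^ 4 \<Rightarrow> real ^ 4" where
  "chris a x u w =
     (a * (x \<bullet> u)) *\<^sub>R w + (a * (x \<bullet> w)) *\<^sub>R u
     - (a * (1 + lapse a x) * (J x \<bullet> u)) *\<^sub>R J w - (a * (1 + lapse a x) * (J x \<bullet> w)) *\<^sub>R J u
     - (a * (u \<bullet> w) + a\<^sup>2 * (lapse a x)\<^sup>2 * (J x \<bullet> u) * (J x \<bullet> w)) *\<^sub>R x
     - (a\<^sup>2 * lapse a x * ((x \<bullet> u) * (J x \<bullet> w) + (x \<bullet> w) * (J x \<bullet> u))) *\<^sub>R J x"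

definition dchris :: "real \<Rightarrow> real ^ 4 \<Rightarrow> real ^ 4 \<Rightarrow> real ^ 4 \<Rightarrow> real ^ 4 \<Rightarrow> real ^ 4" where
  "dchris a x d u w =
     (a * (d \<bullet> u)) *\<^sub>R w + (a * (d \<bullet> w)) *\<^sub>R u
     - (a * (1 + lapse a x) * (J d \<bullet> u) + a * dlapse a x d * (J x \<bullet> u)) *\<^sub>R J w
     - (a * (1 + lapse a x) * (J d \<bullet> w) + a * dlapse a x d * (J x \<bullet> w)) *\<^sub>R J u
     - (a * (u \<bullet> w) + a\<^sup>2 * (lapse a x)\<^sup>2 * (J x \<bullet> u) * (J x \<bullet> w)) *\<^sub>R d
     - (a\<^sup>2 * (2 * lapse a x * dlapse a x d * (J x \<bullet> u) * (J x \<bullet> w)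
          + (lapse a x)\<^sup>2 * ((J d \<bullet> u) * (J x \<bullet> w) + (J x \<bullet> u) * (J d \<bullet> w)))) *\<^sub>R x
     - (a\<^sup>2 * lapse a x * ((x \<bullet> u) * (J x \<bullet> w) + (x \<bullet> w) * (J x \<bullet> u))) *\<^sub>R J d
     - (a\<^sup>2 * (dlapse a x d * ((x \<bullet> u) * (J x \<bullet> w) + (x \<bullet> w) * (J x \<bullet> u))
          + lapse a x * ((d \<bullet> u) * (J x \<bullet> w) + (x \<bullet> u) * (J d \<bullet> w)
              + (d \<bullet> w) * (J x \<bullet> u) + (x \<bullet> w) * (J d \<bullet> u)))) *\<^sub>R J x"

definition christoffel :: "real \<Rightarrow> real ^ 4 \<Rightarrow> real ^ 4 \<Rightarrow> real ^ 4 \<Rightarrow> real ^ 4" where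
  "christoffel a x u w = lapse a x *\<^sub>R chris a x u w"

definition dchristoffel :: "real \<Rightarrow> real ^ 4 \<Rightarrow> real ^ 4 \<Rightarrow> real ^ 4 \<Rightarrow> real ^ 4 \<Rightarrow> real ^ 4" where
  "dchristoffel a x d u w = lapse a x *\<^sub>R dchris a x d u w + dlapse a x d *\<^sub>R chris a x u w"

lemma bilin_taub_nut:
  assumes "a > 0"
  shows "bilin (taub_nut a x) u w = tn_metric a x u w"
proof (rule bilin_eq_bilinear)
  show "bilinear (tn_metric a x)"
    unfolding bilinear_def tn_metric_def by (auto intro!: linearI simp: inner_simps algebra_simps)
next
  have "a * (x \<bullet> x) + 1 \<noteq> 0"
    using assms by (simp add: add_nonneg_pos pos_add_strict less_imp_neq[symmetric])
  then have "a * (a * (x \<bullet> x) + 2) / (a * (x \<bullet> x) + 1) = a * (1 + lapse a x)"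
    by (simp add: lapse_def field_simps)
  moreover have "axis i 1 $ j = (if i = j then 1 else (0::real))" for i j :: 4
    by (simp add: axis_def)
  ultimately show "taub_nut a x $ i $ j = tn_metric a x (axis i 1) (axis j 1)" for i j
    by (simp add: taub_nut_def tn_metric_def inner_axis power2_norm_eq_inner inner_axis_axis)
qed

context
  fixes a :: real
  assumes a: "a > 0"
begin

lemma denominator_pos: "0 < a * (x \<bullet> x) + 1"
  using a by (simp add: add_nonneg_pos)

lemma lapse_pos: "0 < lapse a x"
  using denominator_pos by (simp add: lapse_def)

lemma lapse_eq: "lapse a x * (a * (x \<bullet> x) + 1) = 1"
  using denominator_pos[of x] by (simp add: lapse_def)

lemma has_derivative_lapse:
  assumes "(X has_derivative X') (at t)"
  shows "((\<lambda>t. lapse a (X t)) has_derivative (\<lambda>d. dlapse a (X t) (X' d))) (at t)"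
proof -
  have "a * (X t \<bullet> X t) + 1 \<noteq> 0"
    using denominator_pos[of "X t"] by simp
  then show ?thesis
    unfolding lapse_def dlapse_def
    by (auto intro!: derivative_eq_intros assms simp: inner_commute power2_eq_square algebra_simps)
qed

lemma has_derivative_J:
  assumes "(X has_derivative X') (at t)"
  shows "((\<lambda>t. J (X t)) has_derivative (\<lambda>d. J (X' d))) (at t)"
  using bounded_linear.has_derivative assms linear_J linear_conv_bounded_linear by blast

lemma tn_metric_commute: "tn_metric a x u w = tn_metric a x w u"
  by (simp add: tn_metric_def inner_commute[of u w])

text \<open>\<open>J\<close> is isometric, so Cauchy-Schwarz bounds the subtracted term by
  \<open>a * (1 + lapse) * |x|^2 * |u|^2\<close>; by \<open>lapse_eq\<close> at least
  \<open>lapse * |u|^2\<close> remains.\<close>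

lemma tn_metric_pos:
  assumes "u \<noteq> 0"
  shows "0 < tn_metric a x u u"
proof -
  have "(J x \<bullet> u)\<^sup>2 \<le> (x \<bullet> x) * (u \<bullet> u)"
    using Cauchy_Schwarz_ineq[of "J x" u] by (simp add: inner_J J_J)
  then have "a * (1 + lapse a x) * (J x \<bullet> u)\<^sup>2 \<le> a * (1 + lapse a x) * ((x \<bullet> x) * (u \<bullet> u))"
    using a lapse_pos[of x] by (intro mult_left_mono) auto
  also have "\<dots> = (a * (x \<bullet> x) + 1) * (u \<bullet> u) - lapse a x * (u \<bullet> u)"
    using lapse_eq[of x] by algebra
  also have "\<dots> < (a * (x \<bullet> x) + 1) * (u \<bullet> u)"
    using lapse_pos assms by simp
  finally show ?thesis
    by (simp add: tn_metric_def power2_eq_square algebra_simps)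
qed

text \<open>With \<open>inner_christoffel\<close>, this simplifies the nested Christoffel symbols of
  \<open>curvature_eq\<close>; \<open>lapse_eq\<close> has removed \<open>x \<bullet> x\<close> from
  both right sides.\<close>

lemma inner_J_christoffel:
  "x \<bullet> J (christoffel a x u w)
    = - (a * lapse a x * ((x \<bullet> u) * (x \<bullet> J w) + (x \<bullet> w) * (x \<bullet> J u)))"
proof -
  have "x \<bullet> J (chris a x u w) = - (a * ((x \<bullet> u) * (x \<bullet> J w) + (x \<bullet> w) * (x \<bullet> J u)))"
    using lapse_eq[of x]
    unfolding chris_def J_simps J_J inner_J inner_add_right inner_diff_right inner_scaleR_right
      inner_minus_right by algebra
  then show ?thesis
    by (simp add: christoffel_def J_simps)
qed

lemma inner_christoffel:
  "x \<bullet> christoffel a x u w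
    = 2 * a * lapse a x * ((x \<bullet> u) * (x \<bullet> w) + (1 + lapse a x) * (x \<bullet> J u) * (x \<bullet> J w))
     - (1 - lapse a x) * (u \<bullet> w + a * (lapse a x)\<^sup>2 * (x \<bullet> J u) * (x \<bullet> J w))"
  using lapse_eq[of x]
  unfolding chris_def christoffel_def J_J inner_J inner_add_right inner_diff_right inner_scaleR_right
    inner_minus_right by algebra

text \<open>The conformal factor of the metric cancels the lapse in front of \<open>chris\<close>,
  and the \<open>\<omega>^2\<close> part sees only the component along \<open>J x\<close>.\<close>

lemma tn_metric_christoffel:
  "tn_metric a x (christoffel a x u w) z = chris a x u w \<bullet> z
    + a\<^sup>2 * (1 + lapse a x) * lapse a x * ((x \<bullet> u) * (x \<bullet> J w) + (x \<bullet> w) * (x \<bullet> J u)) * (x \<bullet> J z)"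
proof -
  have "(a * (x \<bullet> x) + 1) * (christoffel a x u w \<bullet> z) = chris a x u w \<bullet> z"
    using lapse_eq[of x] unfolding christoffel_def inner_scaleR_left by algebra
  then show ?thesis
    by (simp add: tn_metric_def inner_J inner_J_christoffel power2_eq_square)
qed

text \<open>The relation \<open>a * (x \<bullet> x) = 1 / lapse a x - 1\<close> has been used to make every coefficient polynomial in \<open>a\<close> and
  the lapse.\<close>

lemma curvature_eq:
  fixes x e u :: "real ^ 4"
  defines "i \<equiv> lapse a x" and "s \<equiv> x \<bullet> e" and "w \<equiv> x \<bullet> J e" and "q \<equiv> e \<bullet> e"
    and "s' \<equiv> x \<bullet> u" and "w' \<equiv> x \<bullet> J u" and "m \<equiv> e \<bullet> u" and "n \<equiv> e \<bullet> J u"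
  shows "dchristoffel a x u e e - dchristoffel a x e e u
      + christoffel a x (christoffel a x e e) u - christoffel a x e (christoffel a x e u)
    = ((3 * a\<^sup>2 * i\<^sup>2 + 6 * a\<^sup>2 * i^3) * w * n + 3 * a\<^sup>2 * i\<^sup>2 * (q * s' - s * m)
        + 6 * a^3 * i^4 * w * (w * s' - s * w')) *\<^sub>R x
      + (3 * a\<^sup>2 * i\<^sup>2 * (w * m - q * w' - s * n) + 6 * a^3 * i^3 * s * (s * w' - w * s')) *\<^sub>R J x
      + ((3 * a * i - a * i\<^sup>2) * m - (2 * a\<^sup>2 * i^4 + 2 * a\<^sup>2 * i^3 + 3 * a\<^sup>2 * i\<^sup>2) * w * w'
        - 3 * a\<^sup>2 * i\<^sup>2 * s * s') *\<^sub>R e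
      + ((6 * a\<^sup>2 * i^3 + 3 * a\<^sup>2 * i\<^sup>2) * (s * w' - w * s') - 3 * a * (i + i\<^sup>2) * n) *\<^sub>R J e
      + ((a * i\<^sup>2 - 3 * a * i) * q + (2 * a\<^sup>2 * i^4 + 2 * a\<^sup>2 * i^3 + 3 * a\<^sup>2 * i\<^sup>2) * w\<^sup>2
        + 3 * a\<^sup>2 * i\<^sup>2 * s\<^sup>2) *\<^sub>R u" (is "?L = ?R")
proof -
  have "?L $ j = ?R $ j" for j
  proof -
    have swap: "u \<bullet> J e = - n" "u \<bullet> e = m" "e \<bullet> x = s" "e \<bullet> J x = - w" "u \<bullet> x = s'" "u \<bullet> J x = - w'"
      by (simp_all add: n_def m_def s_def w_def s'_def w'_def inner_commute inner_J(1)[of _ u] inner_J(1)[of _ e])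
        (metis inner_J(1) inner_commute add.inverse_inverse)+
    \<comment> \<open>The outer symbols are opened first, while products of the inner ones with
      \<open>x\<close> and \<open>J x\<close> still match their short forms. What is left in each
      component is a polynomial identity in the abbreviated scalars and the vector
      components.\<close>
    show ?thesis
      unfolding christoffel_def[of a x "christoffel a x e e"] christoffel_def[of a x e "christoffel a x e u"]
        chris_def[of a x "christoffel a x e e"] chris_def[of a x e "christoffel a x e u"]
        dchristoffel_def dchris_def dlapse_def inner_J J_J inner_christoffel inner_J_christoffel
      unfolding christoffel_def chris_def J_simps J_J inner_J inner_simps inner_minus_right
        swap s_def[symmetric] w_def[symmetric] q_def[symmetric]
        s'_def[symmetric] w'_def[symmetric] m_def[symmetric] n_def[symmetric] i_def[symmetric]
        vector_add_component vector_minus_component vector_scaleR_component vector_uminus_component real_scaleR_def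
      by algebra
  qed
  then show ?thesis
    by (simp add: vec_eq_iff)
qed

text \<open>Metric and connection are built from inner products, \<open>J\<close> and
  \<open>x\<close>; as \<open>wind r\<close> is skew and commutes with \<open>J\<close>, it
  satisfies \<open>killing\<close> and \<open>\<Gamma>_equivariant\<close>.\<close>

lemma killing_navigation_taub_nut:
  "killing_navigation (tn_metric a) (tn_dmetric a) (christoffel a) (dchristoffel a) (wind r)"
proof (rule killing_navigation.intro)
  fix x u w d :: "real ^ 4"
  show "linear (wind r)"
    by (rule linear_wind)
  show "bilinear (tn_metric a x)"
    unfolding bilinear_def tn_metric_def by (auto intro!: linearI simp: inner_simps algebra_simps)
  show "tn_metric a x u w = tn_metric a x w u"
    by (rule tn_metric_commute)
  show "0 < tn_metric a x u u" if "u \<noteq> 0"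
    using that by (rule tn_metric_pos)
  show "bilinear (tn_dmetric a x d)"
    unfolding bilinear_def tn_dmetric_def by (auto intro!: linearI simp: inner_simps algebra_simps)
  show "bilinear (christoffel a x)"
    unfolding bilinear_def christoffel_def chris_def
    by (auto intro!: linearI simp: inner_simps J_simps vec_eq_iff algebra_simps)
  show "christoffel a x u w = christoffel a x w u"
    by (simp add: christoffel_def chris_def inner_commute[of u w] algebra_simps)
  show "bilinear (dchristoffel a x d)"
    unfolding bilinear_def dchristoffel_def dchris_def chris_def
    by (auto intro!: linearI simp: inner_simps J_simps vec_eq_iff algebra_simps)
  show "((\<lambda>(x, u, w). tn_metric a x u w) has_derivative
        (\<lambda>(d, u', w'). tn_dmetric a x d u w + tn_metric a x u' w + tn_metric a x u w')) (at (x, u, w))"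
    unfolding split_def tn_metric_def
    by (auto intro!: derivative_eq_intros has_derivative_lapse has_derivative_J
        simp: tn_dmetric_def inner_commute algebra_simps)
  show "((\<lambda>(x, u, w). christoffel a x u w) has_derivative
        (\<lambda>(d, u', w'). dchristoffel a x d u w + christoffel a x u' w + christoffel a x u w')) (at (x, u, w))"
    unfolding split_def christoffel_def chris_def
    by (auto intro!: derivative_eq_intros has_derivative_lapse has_derivative_J
        simp: dchristoffel_def dchris_def chris_def vec_eq_iff power2_eq_square inner_commute algebra_simps)
  show "tn_dmetric a x d u w = tn_metric a x (christoffel a x d u) w + tn_metric a x u (christoffel a x d w)"
    unfolding tn_metric_commute[of x u "christoffel a x d w"] tn_metric_christoffel tn_dmetric_def dlapse_def chris_def
    by (simp add: inner_simps inner_J J_J inner_commute[of w] inner_commute[of u d] power2_eq_square algebra_simps)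
  show "tn_dmetric a x (wind r x) u w + tn_metric a x (wind r u) w + tn_metric a x u (wind r w) = 0"
    by (simp add: tn_dmetric_def tn_metric_def dlapse_def J_wind inner_wind algebra_simps)
  show "dchristoffel a x (wind r x) u w + christoffel a x (wind r u) w + christoffel a x u (wind r w)
      = wind r (christoffel a x u w)"
    by (simp add: dchristoffel_def christoffel_def dchris_def chris_def dlapse_def J_wind inner_wind wind_simps)
      (simp add: vec_eq_iff algebra_simps)
qed

text \<open>Ricci flatness of \<open>g_a\<close>, read off from \<open>curvature_eq\<close>.\<close>

lemma curvature_trace:
  "(\<Sum>k\<in>UNIV. (dchristoffel a x (axis k 1) e e - dchristoffel a x e e (axis k 1)
      + christoffel a x (christoffel a x e e) (axis k 1) - christoffel a x e (christoffel a x e (axis k 1))) $ k) = 0"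
    (is "(\<Sum>k\<in>UNIV. ?f k) = 0")
proof -
  define i s w q where "i = lapse a x" and "s = x \<bullet> e" and "w = x \<bullet> J e" and "q = e \<bullet> e"
  \<comment> \<open>In \<open>curvature_eq\<close> the coefficients of \<open>x\<close>,
    \<open>J x\<close>, \<open>e\<close>, \<open>J e\<close> are linear in \<open>u\<close>;
    \<open>A\<close>, \<open>B\<close>, \<open>C\<close>, \<open>E\<close> represent them as inner
    products with \<open>u\<close>, and \<open>c\<close> is the coefficient of \<open>u\<close>
    itself. The trace is then four inner products plus \<open>c\<close> times the dimension.\<close>
  define A where "A = (3 * a\<^sup>2 * i\<^sup>2 * q + 6 * a^3 * i^4 * w\<^sup>2) *\<^sub>R x - (3 * a\<^sup>2 * i\<^sup>2 * s) *\<^sub>R e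
    - ((3 * a\<^sup>2 * i\<^sup>2 + 6 * a\<^sup>2 * i^3) * w) *\<^sub>R J e + (6 * a^3 * i^4 * w * s) *\<^sub>R J x"
  define B where "B = (3 * a\<^sup>2 * i\<^sup>2 * w) *\<^sub>R e + (3 * a\<^sup>2 * i\<^sup>2 * q - 6 * a^3 * i^3 * s\<^sup>2) *\<^sub>R J x
    + (3 * a\<^sup>2 * i\<^sup>2 * s) *\<^sub>R J e - (6 * a^3 * i^3 * s * w) *\<^sub>R x"
  define C where "C = (3 * a * i - a * i\<^sup>2) *\<^sub>R e + ((2 * a\<^sup>2 * i^4 + 2 * a\<^sup>2 * i^3 + 3 * a\<^sup>2 * i\<^sup>2) * w) *\<^sub>R J x
    - (3 * a\<^sup>2 * i\<^sup>2 * s) *\<^sub>R x"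
  define E where "E = - ((6 * a\<^sup>2 * i^3 + 3 * a\<^sup>2 * i\<^sup>2) * s) *\<^sub>R J x - ((6 * a\<^sup>2 * i^3 + 3 * a\<^sup>2 * i\<^sup>2) * w) *\<^sub>R x
    + (3 * a * (i + i\<^sup>2)) *\<^sub>R J e"
  define c where "c = (a * i\<^sup>2 - 3 * a * i) * q + (2 * a\<^sup>2 * i^4 + 2 * a\<^sup>2 * i^3 + 3 * a\<^sup>2 * i\<^sup>2) * w\<^sup>2
    + 3 * a\<^sup>2 * i\<^sup>2 * s\<^sup>2"
  have swap: "v \<bullet> J (axis k 1) = - (J v $ k)" "v \<bullet> axis k 1 = v $ k" "axis k 1 $ k = (1::real)" for v k
    using inner_J(1)[of v "axis k 1"] by (simp_all add: inner_axis)
  have "?f k = A $ k * x $ k + B $ k * J x $ k + C $ k * e $ k + E $ k * J e $ k + c" for k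
    unfolding curvature_eq swap i_def[symmetric] s_def[symmetric] w_def[symmetric] q_def[symmetric]
      A_def B_def C_def E_def c_def vector_add_component vector_minus_component vector_scaleR_component
      vector_uminus_component real_scaleR_def
    by algebra
  then have "(\<Sum>k\<in>UNIV. ?f k) = A \<bullet> x + B \<bullet> J x + C \<bullet> e + E \<bullet> J e + 4 * c"
    by (simp add: sum.distrib inner_vec_def)
  also have "\<dots> = 0"
  proof -
    have swap: "e \<bullet> x = s" "x \<bullet> e = s" "e \<bullet> J x = - w" "x \<bullet> J e = w" "e \<bullet> e = q"
      using inner_J(1)[of e x] by (simp_all add: s_def w_def q_def inner_commute)
    have "i * (a * (x \<bullet> x) + 1) = 1"
      by (simp add: i_def lapse_eq)
    then show ?thesis
      unfolding A_def B_def C_def E_def c_def inner_add_left inner_diff_left inner_scaleR_left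
        inner_minus_left J_J inner_J inner_minus_right swap by algebra
  qed
  finally show ?thesis .
qed

text \<open>An instance of the skew-symmetry of the curvature tensor, obtained from the explicit
  formula modulo \<open>lapse_eq\<close>.\<close>

lemma curvature_orthogonal:
  "tn_metric a x e (dchristoffel a x u e e - dchristoffel a x e e u
      + christoffel a x (christoffel a x e e) u - christoffel a x e (christoffel a x e u)) = 0"
proof -
  have swap: "e \<bullet> x = x \<bullet> e" "e \<bullet> J x = - (x \<bullet> J e)"
    using inner_J(1)[of e x] by (simp_all add: inner_commute)
  show ?thesis
    using lapse_eq[of x]
    unfolding curvature_eq tn_metric_def inner_J J_J J_simps inner_add_right inner_diff_right inner_scaleR_right
      inner_minus_right swap
    by algebra
qed

end

section \<open>The Taub-NUT case: Ricci flatness, and two different flag curvatures at the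
  origin\<close>

theorem theorem3p3:
  fixes a r :: real
  assumes "a > 0"
  shows "let F = randers_of_navigation (taub_nut a) (wind r);
             M = Omega a r \<inter> navigation_domain (taub_nut a) (wind r)
         in einstein_metric_on M F \<and> \<not> constant_flag_curvature_on M F"
proof -
  interpret tn: killing_navigation "tn_metric a" "tn_dmetric a" "christoffel a" "dchristoffel a" "wind r"
    using assms by (rule killing_navigation_taub_nut)
  define F where "F = randers_of_navigation (taub_nut a) (wind r)"
  define M where "M = Omega a r \<inter> navigation_domain (taub_nut a) (wind r)"
  have F_eq: "F = (\<lambda>x y. tn.F (x, y))"
    unfolding F_def using tn.randers_of_navigation_eq bilin_taub_nut[OF assms] by blast
  have nav: "navigation_domain (taub_nut a) (wind r) = {x. tn_metric a x (wind r x) (wind r x) < 1}"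
    by (simp add: navigation_domain_def metric_norm_def bilin_taub_nut[OF assms])
  have "open (Omega a r)"
    by (auto simp: Omega_def intro!: open_Collect_less continuous_intros)
  moreover have "open (navigation_domain (taub_nut a) (wind r))"
    unfolding nav by (rule tn.open_speed_less)
  ultimately have "open M"
    by (simp add: M_def open_Int)
  have dom: "(x, y) \<in> tn.Dom" if "x \<in> M" "y \<noteq> 0" for x y
    using that by (simp add: tn.Dom_def M_def nav)
  have "finsler_metric_on M F"
    unfolding F_eq
  proof (rule tn.finsler_metric)
    show "M \<subseteq> {x. tn_metric a x (wind r x) (wind r x) < 1}"
      by (auto simp: M_def nav)
    have lin: "bounded_linear (\<lambda>t::(real ^ 4) \<times> (real ^ 4). fst t)" "bounded_linear (\<lambda>t::(real ^ 4) \<times> (real ^ 4). snd t)"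
      "bounded_linear (\<lambda>t::(real ^ 4) \<times> (real ^ 4). J (fst t))" "bounded_linear (\<lambda>t::(real ^ 4) \<times> (real ^ 4). wind r (fst t))"
      using bounded_linear_compose[OF _ bounded_linear_fst] linear_J linear_wind bounded_linear_fst bounded_linear_snd
      by (auto simp: linear_conv_bounded_linear)
    have *: "smooth_on S (\<lambda>t. tn_metric a (fst t) (f t) (h t))"
      if "bounded_linear f" "bounded_linear h" for S and f h :: "(real ^ 4) \<times> (real ^ 4) \<Rightarrow> real ^ 4"
    proof -
      have "a * (x \<bullet> x) + 1 \<noteq> 0" for x :: "real ^ 4"
        using denominator_pos[OF assms, of x] by simp
      then show ?thesis
        unfolding tn_metric_def lapse_def inverse_eq_divide
        by (intro smooth_on_diff smooth_on_mult smooth_on_add smooth_on_divide smooth_on_const smooth_on_inner lin that)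
    qed
    show "smooth_on (M \<times> (UNIV - {0})) (\<lambda>t. tn_metric a (fst t) (snd t) (snd t))"
      "smooth_on (M \<times> (UNIV - {0})) (\<lambda>t. tn_metric a (fst t) (wind r (fst t)) (snd t))"
      by (intro * lin)+
    show "smooth_on (M \<times> (UNIV - {0 :: real ^ 4})) (\<lambda>t. tn.slope (fst t))"
      unfolding tn.slope_def by (intro smooth_on_diff smooth_on_const *[OF lin(4) lin(4)])
  qed (fact \<open>open M\<close>)
  moreover have "ricci F x y = 0" if "x \<in> M" "y \<noteq> 0" for x y
    unfolding F_eq using dom[OF that]
    by (rule tn.ricci_eq_0) (simp_all add: tn.R_def curvature_trace curvature_orthogonal assms
      del: vector_add_component vector_minus_component)
  ultimately have "einstein_metric_on M F"
    unfolding einstein_metric_on_def by (auto intro!: exI[where x = "\<lambda>x. 0"])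
  moreover have "\<not> constant_flag_curvature_on M F"
  proof
    \<comment> \<open>At the origin \<open>\<omega>\<close> vanishes and the lapse is 1, so
      \<open>g_a\<close> is Euclidean there, and \<open>curvature_eq\<close> keeps two terms when
      \<open>u\<close> is orthogonal to the flag pole.\<close>
    have flag: "flag_curvature F 0 (axis 1 1) u = (6 * a * (axis 1 1 \<bullet> J u) * (axis 1 1 \<bullet> J u) - 2 * a * (u \<bullet> u)) / (u \<bullet> u)"
      if "axis 1 1 \<bullet> u = 0" for u
    proof -
      have "tn_metric a 0 v w = v \<bullet> w" for v w
        by (simp add: tn_metric_def J_simps)
      moreover have "tn.R 0 (axis 1 1) u = - (6 * a * (axis 1 1 \<bullet> J u)) *\<^sub>R J (axis 1 1) - (2 * a) *\<^sub>R u"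
        unfolding tn.R_def curvature_eq[OF assms] using that
        by (simp add: lapse_def inner_axis_axis algebra_simps)
      then have "tn.R 0 (axis 1 1) u \<bullet> u = 6 * a * (axis 1 1 \<bullet> J u) * (axis 1 1 \<bullet> J u) - 2 * a * (u \<bullet> u)"
        by (simp only: inner_diff_left inner_scaleR_left inner_J) simp
      ultimately show ?thesis
        using that unfolding F_eq by (subst tn.flag_curvature_at_fixed_point)
          (simp_all add: wind_simps inner_axis_axis)
    qed
    assume "constant_flag_curvature_on M F"
    then obtain c where c: "\<And>x y u. x \<in> M \<Longrightarrow> dim {y, u} = 2 \<Longrightarrow> flag_curvature F x y u = c"
      unfolding constant_flag_curvature_on_def by blast
    have "0 \<in> M"
      by (simp add: M_def nav Omega_def linear_0[OF linear_wind] tn_metric_def)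
    have orth: "(axis 1 1 :: real ^ 4) \<bullet> axis k 1 = 0" "dim {axis 1 1, axis k 1 :: real ^ 4} = 2" if "k \<noteq> 1" for k
      using that by (auto intro!: dim_orthogonal_pair simp: inner_axis_axis)
    \<comment> \<open>The second axis is \<open>J\<close> of the first, so this flag is a complex
      line, with curvature \<open>6 a - 2 a\<close>; the third axis spans a totally real plane with
      the first and gives \<open>- 2 a\<close>.\<close>
    have "flag_curvature F 0 (axis 1 1) (axis 2 1) = flag_curvature F 0 (axis 1 1) (axis 3 1)"
      using c[OF \<open>0 \<in> M\<close>] orth(2)[of 2] orth(2)[of 3] by simp
    moreover have "J (axis 2 1) $ 1 = - 1" "J (axis 3 1) $ 1 = 0"
      by (simp_all add: J_nth axis_def)
    moreover have "flag_curvature F 0 (axis 1 1) (axis 2 1) = 6 * a * (J (axis 2 1) $ 1)\<^sup>2 - 2 * a"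
      "flag_curvature F 0 (axis 1 1) (axis 3 1) = 6 * a * (J (axis 3 1) $ 1)\<^sup>2 - 2 * a"
      using flag[OF orth(1)[of 2]] flag[OF orth(1)[of 3]]
      by (simp_all add: inner_axis' inner_axis_axis power2_eq_square)
    ultimately show False
      using assms by simp
  qed
  ultimately show ?thesis
    unfolding F_def M_def by simp
qed

end
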